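(* Let $(X,d_X)$ and $(Y,d_Y)$ be metric spaces and $f\colon X\to Y$ a function. Let $\phi_f\colon\ell_\infty(Y)\to\ell_\infty(X)$, $\phi_f(g)=g\circ f$, be the associated quantum function, where $\ell_\infty(X)$ and $\ell_\infty(Y)$ carry their canonical quantum metrics. Then $\tilde{\omega}_{\phi_f} = \tilde{\omega}_f$ and $\tilde{\rho}_{\phi_f} = \tilde{\rho}_f$.
   Context: For a map $f\colon X\to Y$ between metric spaces and $t\ge 0$: $\tilde\omega_f(t)=\inf\{d_X(x,y)\mid d_Y(f(x),f(y))\ge t\}$ and $\tilde\rho_f(t)=\sup\{d_X(x,y)\mid d_Y(f(x),f(y))\le t\}$. Infima and suprema are taken in $[0,\infty]$, with $\inf\emptyset=\infty$. "Projection" means orthogonal projection. A quantum metric on a von Neumann algebra $\mathcal{M}\subseteq \mathcal{B}(\mathcal{H})$ is a family $\{\mathcal{V}_t\}_{t\in[0,\infty)}$ of weak*-closed self-adjoint subspaces of $\mathcal{B}(\mathcal{H})$ with $\mathcal{V}_0=\mathcal{M}'$ (the commutant), $\mathcal{V}_s\mathcal{V}_t\subseteq \mathcal{V}_{s+t}$ for all $s,t\ge0$, and $\mathcal{V}_t=\bigcap_{s>t}\mathcal{V}_s$ for all $t\ge 0$. The canonical quantum metric associated to a metric space $(X,d)$ is the one on $\ell_\infty(X)\subseteq\mathcal{B}(\ell_2(X))$ (diagonal operators) given by $\mathcal{V}_t=\{A\in\mathcal{B}(\ell_2(X))\mid\langle Ae_x,e_y\rangle=0\text{ whenever }d(x,y)>t\}$,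 where $(e_x)_{x\in X}$ is the canonical basis. For projections $P,Q\in\mathcal{M}\overline{\otimes}\mathcal{B}(\ell_2)$ (weak*-closed spatial tensor product), $\operatorname{dist}(P,Q)=\inf\{t\mid P(A\otimes\mathrm{Id})Q\ne0\text{ for some }A\in\mathcal{V}_t\}$; for $P,Q\in\mathcal{M}$, identified with $P\otimes\mathrm{Id},Q\otimes\mathrm{Id}$, this is $\inf\{t\mid PAQ\ne0\text{ for some }A\in\mathcal{V}_t\}$. For a nonzero projection $P\in\mathcal{M}$, $\operatorname{diam}(P)=\sup\{\operatorname{dist}(Q,R)\mid Q(PAP\otimes\mathrm{Id})R\ne0\text{ for some }A\in\mathcal{B}(\mathcal{H})\}$, with $Q,R$ ranging over projections in $\mathcal{M}\overline{\otimes}\mathcal{B}(\ell_2)$; $\operatorname{diam}(0)=0$. A quantum function is a unital weak*-continuous $*$-homomorphism between von Neumann algebras. For a quantum function $\phi\colon\mathcal{M}\to\mathcal{N}$ between quantum metric spaces and $t\ge0$, with $P,Q$ ranging over projections in $\mathcal{M}$: $\tilde\omega_\phi(t)=\inf\{\operatorname{dist}(\phi(P),\phi(Q))\mid\operatorname{dist}(P,Q)\ge t\}$ and $\tilde\rho_\phi(t)=\sup\{\operatorname{diam}(\phi(P))\mid\operatorname{diam}(P)\le t\}$. *)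

theory Defs
  imports "HOL-Analysis.Analysis" "HOL-Library.Function_Algebras"
begin

section \<open>Definitions\<close>

text \<open>
  All Hilbert spaces are taken in the form \<open>\<ell>\<^sub>2(I)\<close> for an index set \<open>I\<close> (choose an orthonormal
  basis), so that \<open>\<ell>\<^sub>2(I) \<otimes> \<ell>\<^sub>2 = \<ell>\<^sub>2(I \<times> \<nat>)\<close>.  Vectors are functions that vanish outside \<open>I\<close>,
  operators are functions that send everything outside \<open>\<ell>\<^sub>2(I)\<close> to 0; hence equality of functions
  is equality of vectors and of operators.  The pointwise operations \<open>+\<close>, \<open>0\<close> come from
  \<open>Function_Algebras\<close>.
\<close>

type_synonym 'i op = "('i \<Rightarrow> complex) \<Rightarrow> ('i \<Rightarrow> complex)"

definition ell2 :: "'i set \<Rightarrow> ('i \<Rightarrow> complex) set" where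
  "ell2 I = {\<psi>. (\<forall>i. i \<notin> I \<longrightarrow> \<psi> i = 0) \<and> (\<lambda>i. (cmod (\<psi> i))\<^sup>2) summable_on UNIV}"

definition ell2_inner :: "('i \<Rightarrow> complex) \<Rightarrow> ('i \<Rightarrow> complex) \<Rightarrow> complex" where
  "ell2_inner \<psi> \<phi> = (\<Sum>\<^sub>\<infinity>i. \<psi> i * cnj (\<phi> i))"

definition ell2_norm :: "('i \<Rightarrow> complex) \<Rightarrow> real" where
  "ell2_norm \<psi> = sqrt (\<Sum>\<^sub>\<infinity>i. (cmod (\<psi> i))\<^sup>2)"

definition basis_vec :: "'i \<Rightarrow> 'i \<Rightarrow> complex" where
  "basis_vec x = (\<lambda>i. if i = x then 1 else 0)"

definition cscale :: "complex \<Rightarrow> ('i \<Rightarrow> complex) \<Rightarrow> ('i \<Rightarrow> complex)" where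
  "cscale c \<psi> = (\<lambda>i. c * \<psi> i)"

definition op_scale :: "complex \<Rightarrow> 'i op \<Rightarrow> 'i op" where
  "op_scale c T = (\<lambda>\<psi>. cscale c (T \<psi>))"

definition bounded_ops :: "'i set \<Rightarrow> 'i op set" where
  "bounded_ops I = {T.
     (\<forall>\<psi>\<in>ell2 I. T \<psi> \<in> ell2 I) \<and>
     (\<forall>\<psi>\<in>ell2 I. \<forall>\<phi>\<in>ell2 I. T (\<psi> + \<phi>) = T \<psi> + T \<phi>) \<and>
     (\<forall>c. \<forall>\<psi>\<in>ell2 I. T (cscale c \<psi>) = cscale c (T \<psi>)) \<and>
     (\<exists>C. \<forall>\<psi>\<in>ell2 I. ell2_norm (T \<psi>) \<le> C * ell2_norm \<psi>) \<and>
     (\<forall>\<psi>. \<psi> \<notin> ell2 I \<longrightarrow> T \<psi> = 0)}"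

definition id_op :: "'i set \<Rightarrow> 'i op" where
  "id_op I = (\<lambda>\<psi>. if \<psi> \<in> ell2 I then \<psi> else 0)"

definition adj :: "'i set \<Rightarrow> 'i op \<Rightarrow> 'i op" where
  "adj I T = (THE S. S \<in> bounded_ops I \<and>
     (\<forall>\<psi>\<in>ell2 I. \<forall>\<phi>\<in>ell2 I. ell2_inner (T \<psi>) \<phi> = ell2_inner \<psi> (S \<phi>)))"

definition projections :: "'i set \<Rightarrow> 'i op set" where
  "projections I = {P \<in> bounded_ops I. P \<circ> P = P \<and> adj I P = P}"

text \<open>The weak* topology of \<open>B(\<ell>\<^sub>2(I))\<close> as the dual of the trace class operators.\<close>

definition normal_functionals :: "'i set \<Rightarrow> ('i op \<Rightarrow> complex) set" where
  "normal_functionals I = {\<lambda>A. \<Sum>n::nat. ell2_inner (A (\<xi> n)) (\<eta> n) | \<xi> \<eta>.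
     (\<forall>n. \<xi> n \<in> ell2 I \<and> \<eta> n \<in> ell2 I) \<and>
     summable (\<lambda>n. (ell2_norm (\<xi> n))\<^sup>2) \<and> summable (\<lambda>n. (ell2_norm (\<eta> n))\<^sup>2)}"

definition weak_star :: "'i set \<Rightarrow> 'i op topology" where
  "weak_star I = topology_generated_by
     {{A \<in> bounded_ops I. \<omega> A \<in> U} | \<omega> U. \<omega> \<in> normal_functionals I \<and> open U}"

definition op_subspace :: "'i op set \<Rightarrow> bool" where
  "op_subspace V \<longleftrightarrow>
     0 \<in> V \<and> (\<forall>A\<in>V. \<forall>B\<in>V. A + B \<in> V) \<and> (\<forall>c. \<forall>A\<in>V. op_scale c A \<in> V)"

definition von_neumann_algebra :: "'i set \<Rightarrow> 'i op set \<Rightarrow> bool" where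
  "von_neumann_algebra I M \<longleftrightarrow>
     M \<subseteq> bounded_ops I \<and> op_subspace M \<and> id_op I \<in> M \<and>
     (\<forall>A\<in>M. \<forall>B\<in>M. A \<circ> B \<in> M) \<and> (\<forall>A\<in>M. adj I A \<in> M) \<and> closedin (weak_star I) M"

definition commutant :: "'i set \<Rightarrow> 'i op set \<Rightarrow> 'i op set" where
  "commutant I M = {A \<in> bounded_ops I. \<forall>B\<in>M. A \<circ> B = B \<circ> A}"

definition quantum_metric :: "'i set \<Rightarrow> 'i op set \<Rightarrow> (real \<Rightarrow> 'i op set) \<Rightarrow> bool" where
  "quantum_metric I M V \<longleftrightarrow>
     (\<forall>t\<ge>0. op_subspace (V t) \<and> closedin (weak_star I) (V t) \<and> (\<forall>A\<in>V t. adj I A \<in> V t)) \<and>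
     V 0 = commutant I M \<and>
     (\<forall>s\<ge>0. \<forall>t\<ge>0. \<forall>A\<in>V s. \<forall>B\<in>V t. A \<circ> B \<in> V (s + t)) \<and>
     (\<forall>t\<ge>0. V t = (\<Inter>s\<in>{t<..}. V s))"

definition quantum_function ::
    "'j set \<Rightarrow> 'j op set \<Rightarrow> 'i set \<Rightarrow> 'i op set \<Rightarrow> ('j op \<Rightarrow> 'i op) \<Rightarrow> bool" where
  "quantum_function J M I N \<phi> \<longleftrightarrow>
     \<phi> ` M \<subseteq> N \<and> \<phi> (id_op J) = id_op I \<and>
     (\<forall>A\<in>M. \<forall>B\<in>M. \<phi> (A + B) = \<phi> A + \<phi> B \<and> \<phi> (A \<circ> B) = \<phi> A \<circ> \<phi> B) \<and>
     (\<forall>c. \<forall>A\<in>M. \<phi> (op_scale c A) = op_scale c (\<phi> A)) \<and>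
     (\<forall>A\<in>M. \<phi> (adj J A) = adj I (\<phi> A)) \<and>
     continuous_map (subtopology (weak_star J) M) (weak_star I) \<phi>"

text \<open>
  \<open>A \<otimes> B = (A \<otimes> Id)(Id \<otimes> B)\<close>, where both factors act slicewise on \<open>\<ell>\<^sub>2(I \<times> J)\<close>;
  see \<open>tensor_op_bounded\<close> and \<open>tensor_op_tensor_vec\<close> below.
\<close>

definition tensor_op :: "'i set \<Rightarrow> 'j set \<Rightarrow> 'i op \<Rightarrow> 'j op \<Rightarrow> ('i \<times> 'j) op" where
  "tensor_op I J A B = (\<lambda>\<psi>. if \<psi> \<in> ell2 (I \<times> J)
     then (\<lambda>(i, n). A (\<lambda>j. B (\<lambda>m. \<psi> (j, m)) n) i) else 0)"

definition tensor_vec :: "('i \<Rightarrow> complex) \<Rightarrow> ('j \<Rightarrow> complex) \<Rightarrow> ('i \<times> 'j \<Rightarrow> complex)" where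
  "tensor_vec \<xi> \<eta> = (\<lambda>(i, j). \<xi> i * \<eta> j)"

text \<open>\<open>amp I A\<close> is \<open>A \<otimes> Id\<close> on \<open>\<ell>\<^sub>2(I) \<otimes> \<ell>\<^sub>2\<close>.\<close>

definition amp :: "'i set \<Rightarrow> 'i op \<Rightarrow> ('i \<times> nat) op" where
  "amp I A = tensor_op I UNIV A (id_op UNIV)"

definition vn_tensor_B_ell2 :: "'i set \<Rightarrow> 'i op set \<Rightarrow> ('i \<times> nat) op set" where
  "vn_tensor_B_ell2 I M = weak_star (I \<times> UNIV) closure_of
     (op_subspace hull {tensor_op I UNIV A B | A B. A \<in> M \<and> B \<in> bounded_ops UNIV})"

record 'i qspace =
  qidx :: "'i set"
  qalg :: "'i op set"
  qmet :: "real \<Rightarrow> 'i op set"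

definition quantum_metric_space :: "'i qspace \<Rightarrow> bool" where
  "quantum_metric_space S \<longleftrightarrow>
     von_neumann_algebra (qidx S) (qalg S) \<and> quantum_metric (qidx S) (qalg S) (qmet S)"

definition proj_alg :: "'i qspace \<Rightarrow> 'i op set" where
  "proj_alg S = projections (qidx S) \<inter> qalg S"

definition proj_amp :: "'i qspace \<Rightarrow> ('i \<times> nat) op set" where
  "proj_amp S = projections (qidx S \<times> UNIV) \<inter> vn_tensor_B_ell2 (qidx S) (qalg S)"

definition qdist_amp :: "'i qspace \<Rightarrow> ('i \<times> nat) op \<Rightarrow> ('i \<times> nat) op \<Rightarrow> ennreal" where
  "qdist_amp S P Q =
     Inf {ennreal t | t. 0 \<le> t \<and> (\<exists>A\<in>qmet S t. P \<circ> amp (qidx S) A \<circ> Q \<noteq> 0)}"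

definition qdist :: "'i qspace \<Rightarrow> 'i op \<Rightarrow> 'i op \<Rightarrow> ennreal" where
  "qdist S P Q = qdist_amp S (amp (qidx S) P) (amp (qidx S) Q)"

definition qdiam :: "'i qspace \<Rightarrow> 'i op \<Rightarrow> ennreal" where
  "qdiam S P = (if P = 0 then 0 else
     Sup {qdist_amp S Q R | Q R. Q \<in> proj_amp S \<and> R \<in> proj_amp S \<and>
       (\<exists>A\<in>bounded_ops (qidx S). Q \<circ> amp (qidx S) (P \<circ> A \<circ> P) \<circ> R \<noteq> 0)})"

text \<open>Here \<open>\<phi>\<close> maps the algebra of \<open>S\<close> to the algebra of \<open>T\<close>.\<close>

definition q_omega :: "'j qspace \<Rightarrow> 'i qspace \<Rightarrow> ('j op \<Rightarrow> 'i op) \<Rightarrow> real \<Rightarrow> ennreal" where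
  "q_omega S T \<phi> t = Inf {qdist T (\<phi> P) (\<phi> Q) | P Q.
     P \<in> proj_alg S \<and> Q \<in> proj_alg S \<and> ennreal t \<le> qdist S P Q}"

definition q_rho :: "'j qspace \<Rightarrow> 'i qspace \<Rightarrow> ('j op \<Rightarrow> 'i op) \<Rightarrow> real \<Rightarrow> ennreal" where
  "q_rho S T \<phi> t = Sup {qdiam T (\<phi> P) | P. P \<in> proj_alg S \<and> qdiam S P \<le> ennreal t}"

definition m_omega :: "'x set \<Rightarrow> ('x \<Rightarrow> 'x \<Rightarrow> real) \<Rightarrow> ('y \<Rightarrow> 'y \<Rightarrow> real) \<Rightarrow> ('x \<Rightarrow> 'y)
    \<Rightarrow> real \<Rightarrow> ennreal" where
  "m_omega X dX dY f t = Inf {ennreal (dX x y) | x y. x \<in> X \<and> y \<in> X \<and> t \<le> dY (f x) (f y)}"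

definition m_rho :: "'x set \<Rightarrow> ('x \<Rightarrow> 'x \<Rightarrow> real) \<Rightarrow> ('y \<Rightarrow> 'y \<Rightarrow> real) \<Rightarrow> ('x \<Rightarrow> 'y)
    \<Rightarrow> real \<Rightarrow> ennreal" where
  "m_rho X dX dY f t = Sup {ennreal (dX x y) | x y. x \<in> X \<and> y \<in> X \<and> dY (f x) (f y) \<le> t}"

definition diag_op :: "'x set \<Rightarrow> ('x \<Rightarrow> complex) \<Rightarrow> 'x op" where
  "diag_op X g = (\<lambda>\<psi>. if \<psi> \<in> ell2 X then (\<lambda>x. g x * \<psi> x) else 0)"

definition linf_alg :: "'x set \<Rightarrow> 'x op set" where
  "linf_alg X = {diag_op X g | g. bounded (g ` X)}"

definition canonical_qspace :: "'x set \<Rightarrow> ('x \<Rightarrow> 'x \<Rightarrow> real) \<Rightarrow> 'x qspace" where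
  "canonical_qspace X d = \<lparr>qidx = X, qalg = linf_alg X,
     qmet = (\<lambda>t. {A \<in> bounded_ops X. \<forall>x\<in>X. \<forall>y\<in>X.
       d x y > t \<longrightarrow> ell2_inner (A (basis_vec x)) (basis_vec y) = 0})\<rparr>"

text \<open>
  The map \<open>g \<mapsto> g \<circ> f\<close> under the identification of a bounded function with its diagonal operator;
  see \<open>pullback_diag_op\<close> and \<open>quantum_function_pullback\<close> below.
\<close>

definition diag_symbol :: "'x op \<Rightarrow> 'x \<Rightarrow> complex" where
  "diag_symbol T x = ell2_inner (T (basis_vec x)) (basis_vec x)"

definition pullback :: "'x set \<Rightarrow> ('x \<Rightarrow> 'y) \<Rightarrow> 'y op \<Rightarrow> 'x op" where
  "pullback X f T = diag_op X (diag_symbol T \<circ> f)"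

section \<open>Operators on \<open>\<ell>\<^sub>2(I)\<close>\<close>

lemma ell2_summable: "\<psi> \<in> ell2 I \<Longrightarrow> (\<lambda>i. (cmod (\<psi> i))\<^sup>2) summable_on UNIV"
  by (simp add: ell2_def)

lemma ell2_outside: "\<psi> \<in> ell2 I \<Longrightarrow> i \<notin> I \<Longrightarrow> \<psi> i = 0"
  by (simp add: ell2_def)

lemma zero_in_ell2 [simp]: "0 \<in> ell2 I"
  by (simp add: ell2_def)

lemma ell2_norm_zero [simp]: "ell2_norm 0 = 0"
  by (simp add: ell2_norm_def)

lemma ell2_norm_nonneg [simp]: "0 \<le> ell2_norm \<psi>"
  by (simp add: ell2_norm_def infsum_nonneg)

lemma ell2_norm_sq: "(ell2_norm \<psi>)\<^sup>2 = (\<Sum>\<^sub>\<infinity>i. (cmod (\<psi> i))\<^sup>2)"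
  by (simp add: ell2_norm_def infsum_nonneg)

lemma sum_le_norm_sq:
  assumes "\<psi> \<in> ell2 I" "finite F"
  shows "(\<Sum>i\<in>F. (cmod (\<psi> i))\<^sup>2) \<le> (ell2_norm \<psi>)\<^sup>2"
  unfolding ell2_norm_sq by (rule finite_sum_le_infsum) (use assms ell2_summable in auto)

lemma L2_set_le_ell2_norm:
  assumes "\<psi> \<in> ell2 I" "finite F"
  shows "L2_set (\<lambda>i. cmod (\<psi> i)) F \<le> ell2_norm \<psi>"
  unfolding L2_set_def using sum_le_norm_sq[OF assms] by (simp add: real_le_lsqrt sum_nonneg)

lemma ell2I:
  assumes "\<And>i. i \<notin> I \<Longrightarrow> \<psi> i = 0" "0 \<le> C"
    and "\<And>F. finite F \<Longrightarrow> F \<subseteq> I \<Longrightarrow> (\<Sum>i\<in>F. (cmod (\<psi> i))\<^sup>2) \<le> C\<^sup>2"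
  shows "\<psi> \<in> ell2 I" and "ell2_norm \<psi> \<le> C"
proof -
  have *: "(\<Sum>i\<in>F. (cmod (\<psi> i))\<^sup>2) \<le> C\<^sup>2" if "finite F" for F
  proof -
    have "(\<Sum>i\<in>F. (cmod (\<psi> i))\<^sup>2) = (\<Sum>i\<in>F \<inter> I. (cmod (\<psi> i))\<^sup>2)"
      using that assms(1) by (intro sum.mono_neutral_right) auto
    then show ?thesis using assms(3)[of "F \<inter> I"] that by simp
  qed
  have s: "(\<lambda>i. (cmod (\<psi> i))\<^sup>2) summable_on UNIV"
    by (rule nonneg_bdd_above_summable_on) (use * in \<open>auto intro!: bdd_aboveI2[where M="C\<^sup>2"]\<close>)
  then show "\<psi> \<in> ell2 I" using assms(1) by (simp add: ell2_def)
  have "(ell2_norm \<psi>)\<^sup>2 \<le> C\<^sup>2"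
    unfolding ell2_norm_sq by (rule infsum_le_finite_sums[OF s]) (use * in auto)
  then show "ell2_norm \<psi> \<le> C" using assms(2) by (rule power2_le_imp_le)
qed

lemma ell2_finite:
  assumes "finite F" "F \<subseteq> I" "\<And>i. i \<notin> F \<Longrightarrow> \<psi> i = 0"
  shows "\<psi> \<in> ell2 I" and "(ell2_norm \<psi>)\<^sup>2 = (\<Sum>i\<in>F. (cmod (\<psi> i))\<^sup>2)"
proof -
  have "((\<lambda>i. (cmod (\<psi> i))\<^sup>2) has_sum (\<Sum>i\<in>F. (cmod (\<psi> i))\<^sup>2)) UNIV"
    using has_sum_cong_neutral[of F UNIV "\<lambda>i. (cmod (\<psi> i))\<^sup>2" "\<lambda>i. (cmod (\<psi> i))\<^sup>2"]
      has_sum_finite[OF assms(1), of "\<lambda>i. (cmod (\<psi> i))\<^sup>2"] assms(3) by simp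
  then show "\<psi> \<in> ell2 I" and "(ell2_norm \<psi>)\<^sup>2 = (\<Sum>i\<in>F. (cmod (\<psi> i))\<^sup>2)"
    using assms by (auto simp: ell2_def ell2_norm_sq has_sum_imp_summable infsumI)
qed

lemma basis_vec_in_ell2_iff [simp]: "basis_vec x \<in> ell2 I \<longleftrightarrow> x \<in> I"
proof
  show "basis_vec x \<in> ell2 I \<Longrightarrow> x \<in> I"
    using ell2_outside[of "basis_vec x" I x] by (auto simp: basis_vec_def)
  show "x \<in> I \<Longrightarrow> basis_vec x \<in> ell2 I"
    by (rule ell2_finite(1)[of "{x}"]) (auto simp: basis_vec_def)
qed

lemma ell2_add:
  assumes "\<psi> \<in> ell2 I" "\<phi> \<in> ell2 I"
  shows "\<psi> + \<phi> \<in> ell2 I" and "ell2_norm (\<psi> + \<phi>) \<le> ell2_norm \<psi> + ell2_norm \<phi>"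
proof -
  have *: "(\<Sum>i\<in>F. (cmod ((\<psi> + \<phi>) i))\<^sup>2) \<le> (ell2_norm \<psi> + ell2_norm \<phi>)\<^sup>2" if "finite F" for F
  proof -
    have "L2_set (\<lambda>i. cmod ((\<psi> + \<phi>) i)) F \<le> L2_set (\<lambda>i. cmod (\<psi> i) + cmod (\<phi> i)) F"
      by (rule L2_set_mono) (auto simp: norm_triangle_ineq)
    also have "\<dots> \<le> L2_set (\<lambda>i. cmod (\<psi> i)) F + L2_set (\<lambda>i. cmod (\<phi> i)) F"
      by (rule L2_set_triangle_ineq)
    also have "\<dots> \<le> ell2_norm \<psi> + ell2_norm \<phi>"
      using L2_set_le_ell2_norm[OF assms(1) that] L2_set_le_ell2_norm[OF assms(2) that] by simp
    finally have "(L2_set (\<lambda>i. cmod ((\<psi> + \<phi>) i)) F)\<^sup>2 \<le> (ell2_norm \<psi> + ell2_norm \<phi>)\<^sup>2"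
      by (rule power_mono) simp
    then show ?thesis by (simp add: L2_set_def sum_nonneg)
  qed
  show "\<psi> + \<phi> \<in> ell2 I" "ell2_norm (\<psi> + \<phi>) \<le> ell2_norm \<psi> + ell2_norm \<phi>"
    by (rule ell2I[where C="ell2_norm \<psi> + ell2_norm \<phi>"];
        use * assms in \<open>auto simp: ell2_outside\<close>)+
qed

lemma ell2_scale [simp]:
  assumes "\<psi> \<in> ell2 I"
  shows "cscale c \<psi> \<in> ell2 I" and "ell2_norm (cscale c \<psi>) = cmod c * ell2_norm \<psi>"
  using assms
  by (auto simp: ell2_def cscale_def ell2_norm_def norm_mult power_mult_distrib
      infsum_cmult_right' real_sqrt_mult intro: summable_on_cmult_right)

lemma inner_summable:
  assumes "\<psi> \<in> ell2 I" "\<phi> \<in> ell2 J"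
  shows "(\<lambda>i. cmod (\<psi> i * cnj (\<phi> i))) summable_on UNIV"
    and "(\<lambda>i. \<psi> i * cnj (\<phi> i)) summable_on UNIV"
    and "(\<Sum>\<^sub>\<infinity>i. cmod (\<psi> i * cnj (\<phi> i))) \<le> ell2_norm \<psi> * ell2_norm \<phi>"
proof -
  have *: "(\<Sum>i\<in>F. cmod (\<psi> i * cnj (\<phi> i))) \<le> ell2_norm \<psi> * ell2_norm \<phi>" if "finite F" for F
  proof -
    have "(\<Sum>i\<in>F. cmod (\<psi> i * cnj (\<phi> i))) = (\<Sum>i\<in>F. \<bar>cmod (\<psi> i)\<bar> * \<bar>cmod (\<phi> i)\<bar>)"
      by (simp add: norm_mult)
    also have "\<dots> \<le> L2_set (\<lambda>i. cmod (\<psi> i)) F * L2_set (\<lambda>i. cmod (\<phi> i)) F"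
      by (rule L2_set_mult_ineq)
    also have "\<dots> \<le> ell2_norm \<psi> * ell2_norm \<phi>"
      using L2_set_le_ell2_norm[OF assms(1) that] L2_set_le_ell2_norm[OF assms(2) that]
      by (intro mult_mono) auto
    finally show ?thesis .
  qed
  show s: "(\<lambda>i. cmod (\<psi> i * cnj (\<phi> i))) summable_on UNIV"
    by (rule nonneg_bdd_above_summable_on)
       (use * in \<open>auto intro!: bdd_aboveI2[where M="ell2_norm \<psi> * ell2_norm \<phi>"]\<close>)
  then show "(\<lambda>i. \<psi> i * cnj (\<phi> i)) summable_on UNIV"
    by (rule abs_summable_summable)
  show "(\<Sum>\<^sub>\<infinity>i. cmod (\<psi> i * cnj (\<phi> i))) \<le> ell2_norm \<psi> * ell2_norm \<phi>"
    by (rule infsum_le_finite_sums[OF s]) (use * in auto)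
qed

lemma ell2_Cauchy_Schwarz:
  assumes "\<psi> \<in> ell2 I" "\<phi> \<in> ell2 J"
  shows "cmod (ell2_inner \<psi> \<phi>) \<le> ell2_norm \<psi> * ell2_norm \<phi>"
  unfolding ell2_inner_def
  using norm_infsum_bound[OF inner_summable(1)[OF assms]] inner_summable(3)[OF assms] by linarith

lemma inner_add_left:
  assumes "\<psi> \<in> ell2 I" "\<psi>' \<in> ell2 I" "\<phi> \<in> ell2 J"
  shows "ell2_inner (\<psi> + \<psi>') \<phi> = ell2_inner \<psi> \<phi> + ell2_inner \<psi>' \<phi>"
  unfolding ell2_inner_def using assms
  by (simp add: distrib_right infsum_add inner_summable)

lemma inner_scale_left: "ell2_inner (cscale c \<psi>) \<phi> = c * ell2_inner \<psi> \<phi>"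
  by (simp add: ell2_inner_def cscale_def mult.assoc infsum_cmult_right')

lemma inner_zero [simp]: "ell2_inner 0 \<phi> = 0" "ell2_inner \<phi> 0 = 0"
  by (simp_all add: ell2_inner_def)

lemma inner_cnj: "ell2_inner \<phi> \<psi> = cnj (ell2_inner \<psi> \<phi>)"
  by (simp add: ell2_inner_def mult.commute flip: infsum_cnj)

lemma inner_add_right:
  assumes "\<psi> \<in> ell2 J" "\<phi> \<in> ell2 I" "\<phi>' \<in> ell2 I"
  shows "ell2_inner \<psi> (\<phi> + \<phi>') = ell2_inner \<psi> \<phi> + ell2_inner \<psi> \<phi>'"
  by (simp add: inner_cnj[of \<psi>] inner_add_left[OF assms(2,3,1)])

lemma inner_scale_right: "ell2_inner \<psi> (cscale c \<phi>) = cnj c * ell2_inner \<psi> \<phi>"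
  by (simp add: inner_cnj[of \<psi>] inner_scale_left)

lemma inner_basis_right [simp]: "ell2_inner \<psi> (basis_vec x) = \<psi> x"
proof -
  have "ell2_inner \<psi> (basis_vec x) = (\<Sum>\<^sub>\<infinity>i\<in>{x}. \<psi> i * cnj (basis_vec x i))"
    unfolding ell2_inner_def by (rule infsum_cong_neutral) (auto simp: basis_vec_def)
  then show ?thesis by (simp add: basis_vec_def)
qed

lemma inner_basis_left [simp]: "ell2_inner (basis_vec x) \<psi> = cnj (\<psi> x)"
  by (subst inner_cnj) simp

lemma bounded_opsD:
  assumes "T \<in> bounded_ops I"
  shows "\<psi> \<in> ell2 I \<Longrightarrow> T \<psi> \<in> ell2 I"
    and "\<psi> \<in> ell2 I \<Longrightarrow> \<phi> \<in> ell2 I \<Longrightarrow> T (\<psi> + \<phi>) = T \<psi> + T \<phi>"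
    and "\<psi> \<in> ell2 I \<Longrightarrow> T (cscale c \<psi>) = cscale c (T \<psi>)"
    and "\<psi> \<notin> ell2 I \<Longrightarrow> T \<psi> = 0"
  using assms by (auto simp: bounded_ops_def)

lemma bounded_opsE:
  assumes "T \<in> bounded_ops I"
  obtains C where "0 \<le> C" "\<And>\<psi>. \<psi> \<in> ell2 I \<Longrightarrow> ell2_norm (T \<psi>) \<le> C * ell2_norm \<psi>"
proof -
  from assms obtain C where C: "\<forall>\<psi>\<in>ell2 I. ell2_norm (T \<psi>) \<le> C * ell2_norm \<psi>"
    by (auto simp: bounded_ops_def)
  show thesis
  proof (rule that[of "max 0 C"])
    fix \<psi> assume "\<psi> \<in> ell2 I"
    with C have "ell2_norm (T \<psi>) \<le> C * ell2_norm \<psi>" by blast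
    also have "\<dots> \<le> max 0 C * ell2_norm \<psi>" by (intro mult_right_mono) auto
    finally show "ell2_norm (T \<psi>) \<le> max 0 C * ell2_norm \<psi>" .
  qed simp
qed

lemma bounded_opsI:
  assumes "\<And>\<psi>. \<psi> \<in> ell2 I \<Longrightarrow> T \<psi> \<in> ell2 I"
    and "\<And>\<psi> \<phi>. \<psi> \<in> ell2 I \<Longrightarrow> \<phi> \<in> ell2 I \<Longrightarrow> T (\<psi> + \<phi>) = T \<psi> + T \<phi>"
    and "\<And>c \<psi>. \<psi> \<in> ell2 I \<Longrightarrow> T (cscale c \<psi>) = cscale c (T \<psi>)"
    and "\<And>\<psi>. \<psi> \<in> ell2 I \<Longrightarrow> ell2_norm (T \<psi>) \<le> C * ell2_norm \<psi>"
    and "\<And>\<psi>. \<psi> \<notin> ell2 I \<Longrightarrow> T \<psi> = 0"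
  shows "T \<in> bounded_ops I"
  using assms unfolding bounded_ops_def by blast

lemma bounded_ops_zero_vec: "T \<in> bounded_ops I \<Longrightarrow> T 0 = 0"
proof -
  assume T: "T \<in> bounded_ops I"
  have "cscale 0 0 = (0 :: 'a \<Rightarrow> complex)" "cscale 0 (T 0) = 0"
    by (simp_all add: cscale_def fun_eq_iff)
  then show "T 0 = 0" using bounded_opsD(3)[OF T, of 0 0] by simp
qed

lemma zero_bounded_op: "0 \<in> bounded_ops I"
  by (rule bounded_opsI[where C=0]) (auto simp: cscale_def fun_eq_iff)

lemma add_bounded_op:
  assumes "A \<in> bounded_ops I" "B \<in> bounded_ops I"
  shows "A + B \<in> bounded_ops I"
proof -
  obtain C D where C: "\<And>\<psi>. \<psi> \<in> ell2 I \<Longrightarrow> ell2_norm (A \<psi>) \<le> C * ell2_norm \<psi>"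
    and D: "\<And>\<psi>. \<psi> \<in> ell2 I \<Longrightarrow> ell2_norm (B \<psi>) \<le> D * ell2_norm \<psi>"
    using assms by (metis bounded_opsE)
  show ?thesis
  proof (rule bounded_opsI[where C="C + D"])
    fix \<psi> assume \<psi>: "\<psi> \<in> ell2 I"
    note A = bounded_opsD(1)[OF assms(1) \<psi>] and B = bounded_opsD(1)[OF assms(2) \<psi>]
    show "(A + B) \<psi> \<in> ell2 I" using ell2_add(1)[OF A B] by simp
    show "ell2_norm ((A + B) \<psi>) \<le> (C + D) * ell2_norm \<psi>"
      using ell2_add(2)[OF A B] C[OF \<psi>] D[OF \<psi>] by (simp add: distrib_right)
    show "(A + B) (cscale c \<psi>) = cscale c ((A + B) \<psi>)" for c
      unfolding plus_fun_apply[where f=A] bounded_opsD(3)[OF assms(1) \<psi>] bounded_opsD(3)[OF assms(2) \<psi>]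
      by (simp add: cscale_def fun_eq_iff distrib_left)
  next
    fix \<psi> \<phi> assume "\<psi> \<in> ell2 I" "\<phi> \<in> ell2 I"
    then show "(A + B) (\<psi> + \<phi>) = (A + B) \<psi> + (A + B) \<phi>"
      by (simp add: bounded_opsD(2)[OF assms(1)] bounded_opsD(2)[OF assms(2)] add_ac)
  qed (simp add: bounded_opsD(4)[OF assms(1)] bounded_opsD(4)[OF assms(2)])
qed

lemma scale_bounded_op:
  assumes "A \<in> bounded_ops I"
  shows "op_scale c A \<in> bounded_ops I"
proof -
  obtain C where C: "\<And>\<psi>. \<psi> \<in> ell2 I \<Longrightarrow> ell2_norm (A \<psi>) \<le> C * ell2_norm \<psi>"
    using assms by (metis bounded_opsE)
  show ?thesis
  proof (rule bounded_opsI[where C="cmod c * C"])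
    fix \<psi> assume \<psi>: "\<psi> \<in> ell2 I"
    show "op_scale c A \<psi> \<in> ell2 I"
      using bounded_opsD(1)[OF assms \<psi>] by (simp add: op_scale_def)
    show "ell2_norm (op_scale c A \<psi>) \<le> cmod c * C * ell2_norm \<psi>"
      using mult_left_mono[OF C[OF \<psi>], of "cmod c"] bounded_opsD(1)[OF assms \<psi>]
      by (simp add: op_scale_def mult.assoc)
    show "op_scale c A (cscale d \<psi>) = cscale d (op_scale c A \<psi>)" for d
      unfolding op_scale_def bounded_opsD(3)[OF assms \<psi>] by (simp add: cscale_def fun_eq_iff)
  next
    fix \<psi> \<phi> assume "\<psi> \<in> ell2 I" "\<phi> \<in> ell2 I"
    then show "op_scale c A (\<psi> + \<phi>) = op_scale c A \<psi> + op_scale c A \<phi>"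
      by (simp add: bounded_opsD(2)[OF assms] op_scale_def cscale_def fun_eq_iff distrib_left)
  qed (simp add: bounded_opsD(4)[OF assms] op_scale_def cscale_def fun_eq_iff)
qed

lemma comp_bounded_op:
  assumes "A \<in> bounded_ops I" "B \<in> bounded_ops I"
  shows "A \<circ> B \<in> bounded_ops I"
proof -
  obtain C D where C: "0 \<le> C" "\<And>\<psi>. \<psi> \<in> ell2 I \<Longrightarrow> ell2_norm (A \<psi>) \<le> C * ell2_norm \<psi>"
    and D: "\<And>\<psi>. \<psi> \<in> ell2 I \<Longrightarrow> ell2_norm (B \<psi>) \<le> D * ell2_norm \<psi>"
    using assms by (metis bounded_opsE)
  show ?thesis
  proof (rule bounded_opsI[where C="C * D"])
    fix \<psi> assume \<psi>: "\<psi> \<in> ell2 I"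
    note B = bounded_opsD(1)[OF assms(2) \<psi>]
    show "(A \<circ> B) \<psi> \<in> ell2 I" using bounded_opsD(1)[OF assms(1) B] by simp
    show "ell2_norm ((A \<circ> B) \<psi>) \<le> C * D * ell2_norm \<psi>"
      using C(2)[OF B] mult_left_mono[OF D[OF \<psi>] C(1)] by (simp add: mult.assoc)
    show "(A \<circ> B) (cscale c \<psi>) = cscale c ((A \<circ> B) \<psi>)" for c
      by (simp add: bounded_opsD(3)[OF assms(1) B] bounded_opsD(3)[OF assms(2) \<psi>])
  next
    fix \<psi> \<phi> assume "\<psi> \<in> ell2 I" "\<phi> \<in> ell2 I"
    then show "(A \<circ> B) (\<psi> + \<phi>) = (A \<circ> B) \<psi> + (A \<circ> B) \<phi>"
      by (simp add: bounded_opsD(1,2)[OF assms(1)] bounded_opsD(1,2)[OF assms(2)])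
  qed (simp add: bounded_opsD(4)[OF assms(2)] bounded_ops_zero_vec[OF assms(1)])
qed

lemma bounded_op_ext:
  assumes "A \<in> bounded_ops I" "B \<in> bounded_ops I" "\<And>\<psi>. \<psi> \<in> ell2 I \<Longrightarrow> A \<psi> = B \<psi>"
  shows "A = B"
  using assms by (metis bounded_opsD(4) ext)

text \<open>Every operator is determined by its matrix.\<close>

lemma bounded_op_has_sum:
  assumes A: "A \<in> bounded_ops I" and \<psi>: "\<psi> \<in> ell2 I" and \<eta>: "\<eta> \<in> ell2 I"
  shows "((\<lambda>i. \<psi> i * ell2_inner (A (basis_vec i)) \<eta>) has_sum ell2_inner (A \<psi>) \<eta>) UNIV"
proof -
  define c where "c = (\<lambda>i. ell2_inner (A (basis_vec i)) \<eta>)"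
  define cut where "cut = (\<lambda>F i. if i \<in> F then \<psi> i else 0)"
  have cut: "cut F \<in> ell2 I \<and> ell2_inner (A (cut F)) \<eta> = (\<Sum>i\<in>F. \<psi> i * c i)" if "finite F" for F
    using that
  proof induction
    case empty
    have "cut {} = 0" by (simp add: cut_def fun_eq_iff)
    then show ?case
      using bounded_ops_zero_vec[OF A] by (metis zero_in_ell2 inner_zero(1) sum.empty)
  next
    case (insert x F)
    show ?case
    proof (cases "x \<in> I")
      case False
      then have "cut (insert x F) = cut F" "\<psi> x = 0"
        using ell2_outside[OF \<psi>] by (auto simp: cut_def fun_eq_iff)
      then show ?thesis using insert by simp
    next
      case True
      have e: "cut (insert x F) = cscale (\<psi> x) (basis_vec x) + cut F"
        using insert by (auto simp: cut_def fun_eq_iff cscale_def basis_vec_def)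
      have 1: "cscale (\<psi> x) (basis_vec x) \<in> ell2 I" using True by simp
      have F: "cut F \<in> ell2 I" using insert by blast
      have "A (cut (insert x F)) = cscale (\<psi> x) (A (basis_vec x)) + A (cut F)"
        using bounded_opsD(2)[OF A 1 F] bounded_opsD(3)[OF A, of "basis_vec x"] True e
        by (metis basis_vec_in_ell2_iff)
      moreover have "cscale (\<psi> x) (A (basis_vec x)) \<in> ell2 I"
        using True by (intro ell2_scale(1) bounded_opsD(1)[OF A]) simp
      ultimately have "ell2_inner (A (cut (insert x F))) \<eta> =
          \<psi> x * c x + ell2_inner (A (cut F)) \<eta>"
        using inner_add_left[OF _ bounded_opsD(1)[OF A F] \<eta>] by (metis c_def inner_scale_left)
      moreover have "cut (insert x F) \<in> ell2 I" using ell2_add(1)[OF 1 F] e by metis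
      ultimately show ?thesis using insert by simp
    qed
  qed
  obtain C where C: "0 \<le> C" "\<And>\<psi>. \<psi> \<in> ell2 I \<Longrightarrow> ell2_norm (A \<psi>) \<le> C * ell2_norm \<psi>"
    using A by (metis bounded_opsE)
  have bound: "cmod ((\<Sum>i\<in>F. \<psi> i * c i) - ell2_inner (A \<psi>) \<eta>)
      \<le> C * ell2_norm \<eta> * sqrt ((ell2_norm \<psi>)\<^sup>2 - (\<Sum>i\<in>F. (cmod (\<psi> i))\<^sup>2))" if F: "finite F" for F
  proof -
    define r where "r = \<psi> + cscale (-1) (cut F)"
    have r: "r \<in> ell2 I" using cut[OF F] \<psi> by (simp add: r_def ell2_add)
    have \<psi>r: "\<psi> = cut F + r" by (simp add: r_def cscale_def fun_eq_iff)
    have "(\<lambda>i. (cmod (\<psi> i))\<^sup>2) summable_on UNIV" using \<psi> by (rule ell2_summable)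
    then have "(\<Sum>\<^sub>\<infinity>i\<in>UNIV - F. (cmod (\<psi> i))\<^sup>2) = (ell2_norm \<psi>)\<^sup>2 - (\<Sum>i\<in>F. (cmod (\<psi> i))\<^sup>2)"
      using F by (simp add: infsum_Diff ell2_norm_sq)
    moreover have "(ell2_norm r)\<^sup>2 = (\<Sum>\<^sub>\<infinity>i\<in>UNIV - F. (cmod (\<psi> i))\<^sup>2)"
      unfolding ell2_norm_sq by (rule infsum_cong_neutral) (auto simp: r_def cscale_def cut_def)
    ultimately have nr: "ell2_norm r = sqrt ((ell2_norm \<psi>)\<^sup>2 - (\<Sum>i\<in>F. (cmod (\<psi> i))\<^sup>2))"
      by (metis ell2_norm_nonneg real_sqrt_unique)
    have "ell2_inner (A \<psi>) \<eta> = ell2_inner (A (cut F)) \<eta> + ell2_inner (A r) \<eta>"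
      using cut[OF F] r \<eta>
      by (subst \<psi>r) (simp add: bounded_opsD[OF A] inner_add_left[of _ I _ _ I])
    then have "(\<Sum>i\<in>F. \<psi> i * c i) - ell2_inner (A \<psi>) \<eta> = - ell2_inner (A r) \<eta>"
      using cut[OF F] by simp
    moreover have "cmod (ell2_inner (A r) \<eta>) \<le> ell2_norm (A r) * ell2_norm \<eta>"
      by (rule ell2_Cauchy_Schwarz[of _ I _ I]) (use r \<eta> A in \<open>auto simp: bounded_opsD\<close>)
    moreover have "ell2_norm (A r) * ell2_norm \<eta> \<le> C * ell2_norm r * ell2_norm \<eta>"
      using C(2)[OF r] by (rule mult_right_mono) simp
    ultimately show ?thesis by (simp add: nr mult_ac)
  qed
  have "((\<lambda>F. \<Sum>i\<in>F. (cmod (\<psi> i))\<^sup>2) \<longlongrightarrow> (ell2_norm \<psi>)\<^sup>2) (finite_subsets_at_top UNIV)"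
    unfolding ell2_norm_sq using has_sum_infsum[OF ell2_summable[OF \<psi>]] by (simp add: has_sum_def)
  then have "((\<lambda>F. C * ell2_norm \<eta> * sqrt ((ell2_norm \<psi>)\<^sup>2 - (\<Sum>i\<in>F. (cmod (\<psi> i))\<^sup>2)))
      \<longlongrightarrow> C * ell2_norm \<eta> * sqrt ((ell2_norm \<psi>)\<^sup>2 - (ell2_norm \<psi>)\<^sup>2)) (finite_subsets_at_top UNIV)"
    by (intro tendsto_intros)
  then have lim: "((\<lambda>F. C * ell2_norm \<eta> * sqrt ((ell2_norm \<psi>)\<^sup>2 - (\<Sum>i\<in>F. (cmod (\<psi> i))\<^sup>2)))
      \<longlongrightarrow> 0) (finite_subsets_at_top UNIV)" by simp
  have "((\<lambda>F. (\<Sum>i\<in>F. \<psi> i * c i) - ell2_inner (A \<psi>) \<eta>) \<longlongrightarrow> 0) (finite_subsets_at_top UNIV)"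
    by (rule Lim_null_comparison[OF _ lim])
       (use bound in \<open>auto intro!: eventually_finite_subsets_at_top_weakI\<close>)
  then show ?thesis
    by (simp add: has_sum_def c_def LIM_zero_iff)
qed

lemma bounded_op_apply_has_sum:
  assumes "A \<in> bounded_ops I" "\<psi> \<in> ell2 I"
  shows "((\<lambda>i. \<psi> i * A (basis_vec i) j) has_sum A \<psi> j) UNIV"
proof (cases "j \<in> I")
  case True
  then show ?thesis using bounded_op_has_sum[OF assms, of "basis_vec j"] by simp
next
  case False
  have "A \<phi> j = 0" for \<phi>
    using False assms(1) by (metis bounded_opsD(1,4) ell2_outside zero_fun_apply)
  then show ?thesis by simp
qed

lemma bounded_op_apply_eq_0:
  assumes "A \<in> bounded_ops I" "\<psi> \<in> ell2 I" "\<And>i. i \<in> I \<Longrightarrow> \<psi> i \<noteq> 0 \<Longrightarrow> A (basis_vec i) j = 0"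
  shows "A \<psi> j = 0"
proof -
  have "\<psi> i * A (basis_vec i) j = 0" for i
    using assms ell2_outside[of \<psi> I i] by (cases "i \<in> I") auto
  then show ?thesis
    using bounded_op_apply_has_sum[OF assms(1,2), of j]
      has_sum_0[of UNIV "\<lambda>i. \<psi> i * A (basis_vec i) j"] has_sum_unique by blast
qed

lemma bounded_op_matrix_ext:
  assumes "A \<in> bounded_ops I" "B \<in> bounded_ops I"
    and "\<And>i j. i \<in> I \<Longrightarrow> j \<in> I \<Longrightarrow> A (basis_vec i) j = B (basis_vec i) j"
  shows "A = B"
proof (rule bounded_op_ext[OF assms(1,2)])
  fix \<psi> assume \<psi>: "\<psi> \<in> ell2 I"
  show "A \<psi> = B \<psi>"
  proof
    fix j
    have "A (basis_vec i) j = B (basis_vec i) j" for i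
      using assms by (metis bounded_opsD(1,4) ell2_outside basis_vec_in_ell2_iff)
    then show "A \<psi> j = B \<psi> j"
      using bounded_op_apply_has_sum[OF assms(1) \<psi>, of j]
        bounded_op_apply_has_sum[OF assms(2) \<psi>, of j] by (simp add: has_sum_unique)
  qed
qed

lemma inner_ext:
  assumes "\<phi> \<in> ell2 I" "\<phi>' \<in> ell2 I" "\<And>\<psi>. \<psi> \<in> ell2 I \<Longrightarrow> ell2_inner \<psi> \<phi> = ell2_inner \<psi> \<phi>'"
  shows "\<phi> = \<phi>'"
proof
  fix i show "\<phi> i = \<phi>' i"
    using assms(3)[of "basis_vec i"] assms(1,2) by (cases "i \<in> I") (auto simp: ell2_outside)
qed

lemma adj_eqI:
  assumes "S \<in> bounded_ops I"
    and "\<And>\<psi> \<phi>. \<psi> \<in> ell2 I \<Longrightarrow> \<phi> \<in> ell2 I \<Longrightarrow> ell2_inner (T \<psi>) \<phi> = ell2_inner \<psi> (S \<phi>)"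
  shows "adj I T = S"
  unfolding adj_def
proof (rule the_equality)
  fix S' assume S': "S' \<in> bounded_ops I \<and>
    (\<forall>\<psi>\<in>ell2 I. \<forall>\<phi>\<in>ell2 I. ell2_inner (T \<psi>) \<phi> = ell2_inner \<psi> (S' \<phi>))"
  show "S' = S"
  proof (rule bounded_op_ext[of _ I])
    fix \<phi> assume "\<phi> \<in> ell2 I"
    then show "S' \<phi> = S \<phi>"
      using S' assms by (intro inner_ext[of _ I]) (auto simp: bounded_opsD)
  qed (use S' assms in auto)
qed (use assms in auto)

lemma adj_exists:
  assumes A: "A \<in> bounded_ops I"
  shows "\<exists>S\<in>bounded_ops I. \<forall>\<psi>\<in>ell2 I. \<forall>\<phi>\<in>ell2 I. ell2_inner (A \<psi>) \<phi> = ell2_inner \<psi> (S \<phi>)"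
proof -
  obtain C where C: "0 \<le> C" "\<And>\<psi>. \<psi> \<in> ell2 I \<Longrightarrow> ell2_norm (A \<psi>) \<le> C * ell2_norm \<psi>"
    using A by (metis bounded_opsE)
  define S where "S = (\<lambda>\<phi>. if \<phi> \<in> ell2 I then (\<lambda>i. cnj (ell2_inner (A (basis_vec i)) \<phi>)) else 0)"
  have Ab: "A (basis_vec i) \<in> ell2 I" for i
    by (cases "basis_vec i \<in> ell2 I")
       (simp_all add: bounded_opsD(1)[OF A] bounded_opsD(4)[OF A] del: basis_vec_in_ell2_iff)
  have S_in: "S \<phi> \<in> ell2 I" and S_norm: "ell2_norm (S \<phi>) \<le> C * ell2_norm \<phi>"
    if \<phi>: "\<phi> \<in> ell2 I" for \<phi>
  proof -
    have out: "S \<phi> i = 0" if "i \<notin> I" for i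
      using that \<phi> by (simp add: S_def bounded_opsD(4)[OF A])
    have fin: "(\<Sum>i\<in>F. (cmod (S \<phi> i))\<^sup>2) \<le> (C * ell2_norm \<phi>)\<^sup>2" if F: "finite F" "F \<subseteq> I" for F
    proof -
      define v where "v = (\<lambda>i. if i \<in> F then S \<phi> i else 0)"
      define s where "s = (\<Sum>i\<in>F. (cmod (S \<phi> i))\<^sup>2)"
      have s0: "0 \<le> s" by (simp add: s_def sum_nonneg)
      have v: "v \<in> ell2 I" by (rule ell2_finite(1)[of F]) (use F in \<open>auto simp: v_def\<close>)
      have "(ell2_norm v)\<^sup>2 = (\<Sum>i\<in>F. (cmod (v i))\<^sup>2)"
        by (rule ell2_finite(2)[of F I]) (use F in \<open>auto simp: v_def\<close>)
      then have nv: "ell2_norm v = sqrt s"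
        by (simp add: v_def s_def real_sqrt_unique)
      have "((\<lambda>i. v i * ell2_inner (A (basis_vec i)) \<phi>) has_sum ell2_inner (A v) \<phi>) UNIV"
        by (rule bounded_op_has_sum[OF A v \<phi>])
      moreover have "((\<lambda>i. v i * ell2_inner (A (basis_vec i)) \<phi>) has_sum of_real s) UNIV"
      proof -
        have "((\<lambda>i. v i * ell2_inner (A (basis_vec i)) \<phi>) has_sum
            (\<Sum>i\<in>F. v i * ell2_inner (A (basis_vec i)) \<phi>)) UNIV"
          using has_sum_cong_neutral[of F UNIV "\<lambda>i. v i * ell2_inner (A (basis_vec i)) \<phi>"
              "\<lambda>i. v i * ell2_inner (A (basis_vec i)) \<phi>"]
            has_sum_finite[OF F(1), of "\<lambda>i. v i * ell2_inner (A (basis_vec i)) \<phi>"]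
          by (simp add: v_def)
        moreover have "(\<Sum>i\<in>F. v i * ell2_inner (A (basis_vec i)) \<phi>) = of_real s"
          unfolding s_def of_real_sum using \<phi>
          by (intro sum.cong refl) (simp add: v_def S_def complex_norm_square mult.commute del: of_real_power)
        ultimately show ?thesis by simp
      qed
      ultimately have "ell2_inner (A v) \<phi> = of_real s" by (rule has_sum_unique)
      then have "s \<le> ell2_norm (A v) * ell2_norm \<phi>"
        using ell2_Cauchy_Schwarz[OF bounded_opsD(1)[OF A v] \<phi>] s0 by simp
      also have "\<dots> \<le> C * sqrt s * ell2_norm \<phi>"
        using C(2)[OF v] by (intro mult_right_mono) (simp_all add: nv)
      finally have "sqrt s * sqrt s \<le> C * ell2_norm \<phi> * sqrt s"
        using s0 by (simp add: mult_ac)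
      then have "sqrt s \<le> C * ell2_norm \<phi>"
        using mult_right_le_imp_le[of "sqrt s" "sqrt s" "C * ell2_norm \<phi>"] s0 C(1)
        by (cases "s = 0") auto
      then have "(sqrt s)\<^sup>2 \<le> (C * ell2_norm \<phi>)\<^sup>2" by (rule power_mono) (simp add: s0)
      then show ?thesis using s0 by (simp add: s_def)
    qed
    show "S \<phi> \<in> ell2 I" "ell2_norm (S \<phi>) \<le> C * ell2_norm \<phi>"
      by (rule ell2I[where C="C * ell2_norm \<phi>"]; use out fin C in auto)+
  qed
  have "S \<in> bounded_ops I"
  proof (rule bounded_opsI[OF S_in _ _ S_norm])
    fix \<psi> \<phi> assume "\<psi> \<in> ell2 I" "\<phi> \<in> ell2 I"
    then show "S (\<psi> + \<phi>) = S \<psi> + S \<phi>"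
      using Ab by (simp add: S_def ell2_add(1) fun_eq_iff inner_add_right[of _ I _ I])
  next
    fix c \<psi> assume "\<psi> \<in> ell2 I"
    then show "S (cscale c \<psi>) = cscale c (S \<psi>)"
      by (simp add: S_def fun_eq_iff inner_scale_right)
         (simp add: cscale_def)
  qed (auto simp: S_def)
  moreover have "ell2_inner (A \<psi>) \<phi> = ell2_inner \<psi> (S \<phi>)" if "\<psi> \<in> ell2 I" "\<phi> \<in> ell2 I" for \<psi> \<phi>
    using infsumI[OF bounded_op_has_sum[OF A that]] that by (simp add: ell2_inner_def[of \<psi>] S_def)
  ultimately show ?thesis by blast
qed

lemma adj_bounded_op: "A \<in> bounded_ops I \<Longrightarrow> adj I A \<in> bounded_ops I"
  and inner_adj: "A \<in> bounded_ops I \<Longrightarrow> \<psi> \<in> ell2 I \<Longrightarrow> \<phi> \<in> ell2 I \<Longrightarrow>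
    ell2_inner (A \<psi>) \<phi> = ell2_inner \<psi> (adj I A \<phi>)"
  using adj_exists[of A I] adj_eqI[of _ I A] by auto

lemma adj_matrix:
  assumes "A \<in> bounded_ops I" "i \<in> I" "j \<in> I"
  shows "adj I A (basis_vec i) j = cnj (A (basis_vec j) i)"
  using inner_adj[OF assms(1), of "basis_vec j" "basis_vec i"] assms(2,3)
  by (metis basis_vec_in_ell2_iff complex_cnj_cnj inner_basis_left inner_basis_right)

section \<open>The canonical quantum metric and the pullback\<close>

lemma op_scale_apply [simp]: "op_scale c A \<psi> i = c * A \<psi> i"
  by (simp add: op_scale_def cscale_def)

lemma normal_functional_coeff:
  assumes "\<phi> \<in> ell2 I" "\<psi> \<in> ell2 I"
  shows "(\<lambda>A. ell2_inner (A \<phi>) \<psi>) \<in> normal_functionals I"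
proof -
  define \<xi> where "\<xi> = (\<lambda>n::nat. if n = 0 then \<phi> else 0)"
  define \<eta> where "\<eta> = (\<lambda>n::nat. if n = 0 then \<psi> else 0)"
  have "(\<Sum>n. ell2_inner (A (\<xi> n)) (\<eta> n)) = ell2_inner (A \<phi>) \<psi>" for A :: "'a op"
    using suminf_finite[of "{0::nat}" "\<lambda>n. ell2_inner (A (\<xi> n)) (\<eta> n)"]
    by (simp add: \<xi>_def \<eta>_def)
  then have "(\<lambda>A. ell2_inner (A \<phi>) \<psi>) = (\<lambda>A. \<Sum>n. ell2_inner (A (\<xi> n)) (\<eta> n))"
    by (simp add: fun_eq_iff)
  moreover have "\<forall>n. \<xi> n \<in> ell2 I \<and> \<eta> n \<in> ell2 I"
    using assms by (simp add: \<xi>_def \<eta>_def)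
  moreover have "summable (\<lambda>n. (ell2_norm (\<xi> n))\<^sup>2)" "summable (\<lambda>n. (ell2_norm (\<eta> n))\<^sup>2)"
    by (rule summable_finite[of "{0}"]; simp add: \<xi>_def \<eta>_def)+
  ultimately show ?thesis
    unfolding normal_functionals_def by blast
qed

lemma topspace_weak_star [simp]: "topspace (weak_star I) = bounded_ops I"
proof -
  have "(\<lambda>A. ell2_inner (A 0) 0) \<in> normal_functionals I"
    by (rule normal_functional_coeff) simp_all
  then have "bounded_ops I \<in> {{A \<in> bounded_ops I. \<omega> A \<in> U} | \<omega> U.
      \<omega> \<in> normal_functionals I \<and> open U}"
    by (intro CollectI exI[of _ "\<lambda>A. ell2_inner (A 0) 0"] exI[of _ UNIV]) auto
  then show ?thesis
    unfolding weak_star_def topology_generated_by_topspace by blast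
qed

lemma weak_star_functional_continuous:
  assumes "\<omega> \<in> normal_functionals I"
  shows "continuous_map (weak_star I) euclidean \<omega>"
  unfolding continuous_map_def
proof (intro conjI allI impI)
  fix U :: "complex set" assume "openin euclidean U"
  then have "open U" by simp
  then show "openin (weak_star I) {x \<in> topspace (weak_star I). \<omega> x \<in> U}"
    using assms unfolding topspace_weak_star unfolding weak_star_def
    by (intro topology_generated_by_Basis) blast
qed auto

lemma closedin_matrix_zeros:
  "closedin (weak_star I) {A \<in> bounded_ops I. \<forall>x\<in>I. \<forall>y\<in>I. R x y \<longrightarrow> A (basis_vec x) y = 0}"
proof -
  have c: "closedin (weak_star I) {A \<in> bounded_ops I. A (basis_vec x) y = 0}"
    if "x \<in> I" "y \<in> I" for x y
    using closedin_continuous_map_preimage[OF weak_star_functional_continuous[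
          OF normal_functional_coeff[of "basis_vec x" I "basis_vec y"]], of "{0}"] that
    by simp
  define K where "K = insert (bounded_ops I)
    ((\<lambda>(x, y). {A \<in> bounded_ops I. A (basis_vec x) y = 0}) ` {(x, y). x \<in> I \<and> y \<in> I \<and> R x y})"
  have "closedin (weak_star I) (\<Inter>K)"
    by (rule closedin_Inter) (use c closedin_topspace[of "weak_star I"] in \<open>auto simp: K_def\<close>)
  moreover have "\<Inter>K = {A \<in> bounded_ops I. \<forall>x\<in>I. \<forall>y\<in>I. R x y \<longrightarrow> A (basis_vec x) y = 0}"
    by (auto simp: K_def)
  ultimately show ?thesis by simp
qed

lemma op_subspace_matrix_zeros:
  "op_subspace {A \<in> bounded_ops I. \<forall>x\<in>I. \<forall>y\<in>I. R x y \<longrightarrow> A (basis_vec x) y = 0}"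
  by (auto simp: op_subspace_def zero_bounded_op add_bounded_op scale_bounded_op)

lemma diag_op_vec:
  assumes "bounded (g ` X)" "\<psi> \<in> ell2 X"
  shows "(\<lambda>x. g x * \<psi> x) \<in> ell2 X"
    and "(\<And>x. x \<in> X \<Longrightarrow> cmod (g x) \<le> K) \<Longrightarrow> 0 \<le> K \<Longrightarrow>
      ell2_norm (\<lambda>x. g x * \<psi> x) \<le> K * ell2_norm \<psi>"
proof -
  have *: "(\<lambda>x. g x * \<psi> x) \<in> ell2 X \<and> ell2_norm (\<lambda>x. g x * \<psi> x) \<le> K * ell2_norm \<psi>"
    if K: "\<And>x. x \<in> X \<Longrightarrow> cmod (g x) \<le> K" "0 \<le> K" for K
  proof -
    have "(\<Sum>x\<in>F. (cmod (g x * \<psi> x))\<^sup>2) \<le> (K * ell2_norm \<psi>)\<^sup>2" if F: "finite F" "F \<subseteq> X" for F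
    proof -
      have "(\<Sum>x\<in>F. (cmod (g x * \<psi> x))\<^sup>2) \<le> (\<Sum>x\<in>F. K\<^sup>2 * (cmod (\<psi> x))\<^sup>2)"
        using F K by (intro sum_mono) (auto simp: norm_mult power_mult_distrib
            intro!: mult_right_mono power_mono)
      also have "\<dots> \<le> K\<^sup>2 * (ell2_norm \<psi>)\<^sup>2"
        using sum_le_norm_sq[OF assms(2) F(1)] by (simp add: mult_left_mono flip: sum_distrib_left)
      finally show ?thesis by (simp add: power_mult_distrib)
    qed
    then show ?thesis
      using ell2I[of X "\<lambda>x. g x * \<psi> x" "K * ell2_norm \<psi>"] K(2) assms(2)
      by (simp add: ell2_outside)
  qed
  obtain L where "0 < L" "\<And>x. x \<in> X \<Longrightarrow> cmod (g x) \<le> L"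
    using assms(1) by (auto simp: bounded_pos)
  with *[of L] show "(\<lambda>x. g x * \<psi> x) \<in> ell2 X" by simp
  show "(\<And>x. x \<in> X \<Longrightarrow> cmod (g x) \<le> K) \<Longrightarrow> 0 \<le> K \<Longrightarrow>
      ell2_norm (\<lambda>x. g x * \<psi> x) \<le> K * ell2_norm \<psi>" using * by simp
qed

lemma diag_op_bounded:
  assumes "bounded (g ` X)"
  shows "diag_op X g \<in> bounded_ops X"
proof -
  obtain K where K: "0 < K" "\<And>x. x \<in> X \<Longrightarrow> cmod (g x) \<le> K"
    using assms by (auto simp: bounded_pos)
  show ?thesis
  proof (rule bounded_opsI[where C=K])
    fix \<psi> assume "\<psi> \<in> ell2 X"
    then show "diag_op X g \<psi> \<in> ell2 X" "ell2_norm (diag_op X g \<psi>) \<le> K * ell2_norm \<psi>"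
      using diag_op_vec[OF assms, of \<psi>] K by (simp_all add: diag_op_def)
  next
    fix \<psi> \<phi> assume "\<psi> \<in> ell2 X" "\<phi> \<in> ell2 X"
    then show "diag_op X g (\<psi> + \<phi>) = diag_op X g \<psi> + diag_op X g \<phi>"
      by (simp add: diag_op_def ell2_add(1) fun_eq_iff distrib_left)
  next
    fix c \<psi> assume "\<psi> \<in> ell2 X"
    then show "diag_op X g (cscale c \<psi>) = cscale c (diag_op X g \<psi>)"
      by (simp add: diag_op_def) (simp add: cscale_def fun_eq_iff)
  qed (simp add: diag_op_def)
qed

lemma diag_op_basis [simp]:
  "x \<in> X \<Longrightarrow> diag_op X g (basis_vec x) = (\<lambda>y. if y = x then g x else 0)"
  by (simp add: diag_op_def fun_eq_iff) (simp add: basis_vec_def)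

lemma diag_op_cong: "(\<And>x. x \<in> X \<Longrightarrow> g x = h x) \<Longrightarrow> diag_op X g = diag_op X h"
proof -
  assume *: "\<And>x. x \<in> X \<Longrightarrow> g x = h x"
  have "g x * \<psi> x = h x * \<psi> x" if "\<psi> \<in> ell2 X" for \<psi> x
    using * ell2_outside[OF that, of x] by (cases "x \<in> X") auto
  then show ?thesis by (auto simp: diag_op_def fun_eq_iff)
qed

lemma diag_symbol_diag_op [simp]: "x \<in> X \<Longrightarrow> diag_symbol (diag_op X g) x = g x"
  by (simp add: diag_symbol_def)

lemma linf_alg_eq:
  "linf_alg X = {A \<in> bounded_ops X. \<forall>x\<in>X. \<forall>y\<in>X. x \<noteq> y \<longrightarrow> A (basis_vec x) y = 0}"
proof (intro set_eqI iffI)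
  fix A assume "A \<in> linf_alg X"
  then show "A \<in> {A \<in> bounded_ops X. \<forall>x\<in>X. \<forall>y\<in>X. x \<noteq> y \<longrightarrow> A (basis_vec x) y = 0}"
    by (auto simp: linf_alg_def diag_op_bounded)
next
  fix A assume "A \<in> {A \<in> bounded_ops X. \<forall>x\<in>X. \<forall>y\<in>X. x \<noteq> y \<longrightarrow> A (basis_vec x) y = 0}"
  then have A: "A \<in> bounded_ops X"
    and off: "\<And>x y. x \<in> X \<Longrightarrow> y \<in> X \<Longrightarrow> x \<noteq> y \<Longrightarrow> A (basis_vec x) y = 0"
    by auto
  obtain C where C: "\<And>\<psi>. \<psi> \<in> ell2 X \<Longrightarrow> ell2_norm (A \<psi>) \<le> C * ell2_norm \<psi>"
    using A by (metis bounded_opsE)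
  have "cmod (A (basis_vec x) x) \<le> C" if x: "x \<in> X" for x
  proof -
    have n: "ell2_norm (basis_vec x) = 1"
      using ell2_finite(2)[of "{x}" X "basis_vec x"] x
      by (simp add: basis_vec_def power2_eq_1_iff)
         (metis ell2_norm_nonneg not_one_le_zero neg_0_le_iff_le)
    have "cmod (A (basis_vec x) x) \<le> ell2_norm (A (basis_vec x))"
      using L2_set_le_ell2_norm[OF bounded_opsD(1)[OF A, of "basis_vec x"], of "{x}"] x by simp
    then show ?thesis using C[of "basis_vec x"] x n by simp
  qed
  then have g: "bounded ((\<lambda>x. A (basis_vec x) x) ` X)"
    by (auto simp: bounded_iff)
  have "A = diag_op X (\<lambda>x. A (basis_vec x) x)"
    by (rule bounded_op_matrix_ext[OF A diag_op_bounded[OF g]]) (use off in auto)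
  then show "A \<in> linf_alg X" using g by (auto simp: linf_alg_def)
qed

lemma adj_diag_op:
  assumes "bounded (g ` X)"
  shows "adj X (diag_op X g) = diag_op X (\<lambda>x. cnj (g x))"
proof (rule adj_eqI)
  have "bounded ((\<lambda>x. cnj (g x)) ` X)" using assms by (simp add: bounded_iff)
  then show "diag_op X (\<lambda>x. cnj (g x)) \<in> bounded_ops X" by (rule diag_op_bounded)
qed (simp add: diag_op_def ell2_inner_def mult_ac)

lemma diag_op_comp:
  assumes "bounded (g ` X)" "bounded (h ` X)"
  shows "diag_op X g \<circ> diag_op X h = diag_op X (\<lambda>x. g x * h x)"
proof
  fix \<psi>
  show "(diag_op X g \<circ> diag_op X h) \<psi> = diag_op X (\<lambda>x. g x * h x) \<psi>"
  proof (cases "\<psi> \<in> ell2 X")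
    case True
    then show ?thesis using diag_op_vec(1)[OF assms(2)] by (simp add: diag_op_def mult_ac)
  next
    case False
    then show ?thesis by (simp add: diag_op_def fun_eq_iff)
  qed
qed

lemma bounded_image_mult:
  fixes g h :: "'x \<Rightarrow> complex"
  assumes "bounded (g ` X)" "bounded (h ` X)"
  shows "bounded ((\<lambda>x. g x * h x) ` X)"
proof -
  obtain K L where "\<And>x. x \<in> X \<Longrightarrow> cmod (g x) \<le> K" "\<And>x. x \<in> X \<Longrightarrow> cmod (h x) \<le> L" "0 < K"
    using assms by (auto simp: bounded_pos)
  then have "cmod (g x * h x) \<le> K * L" if "x \<in> X" for x
    using that by (auto simp: norm_mult intro!: mult_mono)
  then show ?thesis by (auto simp: bounded_iff)
qed

lemma von_neumann_algebra_linf: "von_neumann_algebra X (linf_alg X)"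
  unfolding von_neumann_algebra_def
proof (intro conjI ballI)
  show "linf_alg X \<subseteq> bounded_ops X" by (auto simp: linf_alg_eq)
  show "op_subspace (linf_alg X)" "closedin (weak_star X) (linf_alg X)"
    unfolding linf_alg_eq by (rule op_subspace_matrix_zeros closedin_matrix_zeros)+
  have "id_op X = diag_op X (\<lambda>_. 1)" by (simp add: id_op_def diag_op_def fun_eq_iff)
  moreover have "bounded ((\<lambda>_. 1 :: complex) ` X)" by (auto simp: bounded_iff)
  ultimately show "id_op X \<in> linf_alg X" by (auto simp: linf_alg_def)
next
  fix A B assume "A \<in> linf_alg X" "B \<in> linf_alg X"
  then show "A \<circ> B \<in> linf_alg X"
    by (auto simp: linf_alg_def diag_op_comp intro!: bounded_image_mult)
next
  fix A assume "A \<in> linf_alg X"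
  then show "adj X A \<in> linf_alg X"
    unfolding linf_alg_eq by (simp add: adj_bounded_op adj_matrix)
qed

lemma commutant_linf: "commutant X (linf_alg X) = linf_alg X"
proof
  show "linf_alg X \<subseteq> commutant X (linf_alg X)"
    by (auto simp: commutant_def linf_alg_def diag_op_comp diag_op_bounded mult.commute)
  show "commutant X (linf_alg X) \<subseteq> linf_alg X"
  proof
    fix A assume "A \<in> commutant X (linf_alg X)"
    then have A: "A \<in> bounded_ops X" and comm: "\<And>B. B \<in> linf_alg X \<Longrightarrow> A \<circ> B = B \<circ> A"
      by (auto simp: commutant_def)
    have "A (basis_vec x) y = 0" if xy: "x \<in> X" "y \<in> X" "x \<noteq> y" for x y
    proof -
      let ?D = "diag_op X (basis_vec x)"
      have "bounded (basis_vec x ` X)" by (auto simp: bounded_iff basis_vec_def intro!: exI[of _ 1])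
      then have "?D \<in> linf_alg X" by (auto simp: linf_alg_def)
      then have "A (?D (basis_vec x)) = ?D (A (basis_vec x))" by (metis comm comp_apply)
      moreover have "?D (basis_vec x) = basis_vec x"
        using xy by (simp add: fun_eq_iff) (simp add: basis_vec_def)
      moreover have "?D (A (basis_vec x)) y = 0"
        using xy bounded_opsD(1)[OF A, of "basis_vec x"] by (simp add: diag_op_def) (simp add: basis_vec_def)
      ultimately show ?thesis by simp
    qed
    then show "A \<in> linf_alg X" using A by (simp add: linf_alg_eq)
  qed
qed

lemma canonical_quantum_metric_space:
  assumes "Metric_space X d"
  shows "quantum_metric_space (canonical_qspace X d)"
proof -
  interpret Metric_space X d by fact
  define V where "V = (\<lambda>t. {A \<in> bounded_ops X. \<forall>x\<in>X. \<forall>y\<in>X. t < d x y \<longrightarrow> A (basis_vec x) y = 0})"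
  have "quantum_metric X (linf_alg X) V"
    unfolding quantum_metric_def
  proof (intro conjI allI impI ballI)
    fix t :: real assume t: "0 \<le> t"
    show "op_subspace (V t)" "closedin (weak_star X) (V t)"
      unfolding V_def by (rule op_subspace_matrix_zeros closedin_matrix_zeros)+
    show "adj X A \<in> V t" if "A \<in> V t" for A
      using that by (auto simp: V_def adj_bounded_op adj_matrix commute)
    show "V t = (\<Inter>s\<in>{t<..}. V s)"
    proof (intro subset_antisym subsetI)
      fix A assume *: "A \<in> (\<Inter>s\<in>{t<..}. V s)"
      then have "A \<in> V (t + 1)" by auto
      then have "A \<in> bounded_ops X" by (simp add: V_def)
      moreover have "A (basis_vec x) y = 0" if xy: "x \<in> X" "y \<in> X" "t < d x y" for x y
      proof -
        obtain s where s: "t < s" "s < d x y" using dense[OF xy(3)] by blast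
        with * have "A \<in> V s" by auto
        then show ?thesis using xy s by (simp add: V_def)
      qed
      ultimately show "A \<in> V t" by (simp add: V_def)
    qed (auto simp: V_def)
  next
    show "V 0 = commutant X (linf_alg X)"
      unfolding commutant_linf unfolding V_def linf_alg_eq
      by (intro Collect_cong conj_cong refl ball_cong) (use mdist_pos_eq in auto)
  next
    fix s t :: real and A B assume st: "0 \<le> s" "0 \<le> t" and "A \<in> V s" "B \<in> V t"
    then have A: "A \<in> bounded_ops X" and B: "B \<in> bounded_ops X"
      and A0: "\<And>x y. x \<in> X \<Longrightarrow> y \<in> X \<Longrightarrow> s < d x y \<Longrightarrow> A (basis_vec x) y = 0"
      and B0: "\<And>x y. x \<in> X \<Longrightarrow> y \<in> X \<Longrightarrow> t < d x y \<Longrightarrow> B (basis_vec x) y = 0"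
      by (auto simp: V_def)
    have "A (B (basis_vec x)) y = 0" if xy: "x \<in> X" "y \<in> X" "s + t < d x y" for x y
    proof (rule bounded_op_apply_eq_0[OF A])
      show "B (basis_vec x) \<in> ell2 X" using bounded_opsD(1)[OF B, of "basis_vec x"] xy by simp
      fix i assume i: "i \<in> X" "B (basis_vec x) i \<noteq> 0"
      then have "d x i \<le> t" using B0[OF xy(1) i(1)] by force
      then have "s < d i y" using triangle[OF xy(1) i(1) xy(2)] xy(3) by linarith
      then show "A (basis_vec i) y = 0" using A0[OF i(1) xy(2)] by simp
    qed
    then show "A \<circ> B \<in> V (s + t)" using comp_bounded_op[OF A B] by (simp add: V_def)
  qed
  then show ?thesis
    by (simp add: quantum_metric_space_def canonical_qspace_def von_neumann_algebra_linf V_def)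
qed

lemma pullback_diag_op:
  assumes "f \<in> X \<rightarrow> Y"
  shows "pullback X f (diag_op Y g) = diag_op X (g \<circ> f)"
  unfolding pullback_def by (rule diag_op_cong) (use assms in \<open>auto simp: Pi_iff\<close>)

lemma normal_fiber_sum:
  fixes f :: "'x \<Rightarrow> 'y"
  assumes \<xi>: "\<xi> \<in> ell2 X" and \<eta>: "\<eta> \<in> ell2 X" and f: "f \<in> X \<rightarrow> Y"
  shows "\<exists>u v. u \<in> ell2 Y \<and> v \<in> ell2 Y \<and>
    (ell2_norm u)\<^sup>2 \<le> ell2_norm \<xi> * ell2_norm \<eta> \<and> (ell2_norm v)\<^sup>2 \<le> ell2_norm \<xi> * ell2_norm \<eta> \<and>
    (\<forall>g. bounded (g ` Y) \<longrightarrow>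
      ell2_inner (diag_op X (g \<circ> f) \<xi>) \<eta> = ell2_inner (diag_op Y g u) v)"
proof -
  define p where "p = (\<lambda>x. \<xi> x * cnj (\<eta> x))"
  define fib where "fib = (\<lambda>y. {x \<in> X. f x = y})"
  define k where "k = (\<lambda>y. \<Sum>\<^sub>\<infinity>x\<in>fib y. p x)"
  define u where "u = (\<lambda>y. complex_of_real (sqrt (cmod (k y))))"
  define v where "v = (\<lambda>y. if k y = 0 then 0 else cnj (k y) / complex_of_real (sqrt (cmod (k y))))"
  have bij: "bij_betw snd (Sigma UNIV fib) X"
    by (rule bij_betw_byWitness[where f'="\<lambda>x. (f x, x)"]) (auto simp: fib_def)
  have p0: "p x = 0" if "x \<notin> X" for x using that \<xi> by (simp add: p_def ell2_outside)
  have abs_p: "(\<lambda>x. cmod (p x)) summable_on UNIV"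
    and bound_p: "(\<Sum>\<^sub>\<infinity>x. cmod (p x)) \<le> ell2_norm \<xi> * ell2_norm \<eta>"
    using inner_summable[OF \<xi> \<eta>] by (simp_all add: p_def)
  have abs_X: "(\<lambda>x. cmod (p x)) summable_on A" for A
    using abs_p by (rule summable_on_subset) simp
  have abs_S: "(\<lambda>z. cmod (p (snd z))) summable_on (Sigma UNIV fib)"
    using summable_on_reindex_bij_betw[OF bij, of "\<lambda>x. cmod (p x)"] abs_X by simp
  define q where "q = (\<lambda>y. \<Sum>\<^sub>\<infinity>x\<in>fib y. cmod (p x))"
  have q: "q summable_on UNIV"
    using summable_on_Sigma_banach[of "\<lambda>y x. cmod (p x)" UNIV fib] abs_S
    by (simp add: q_def case_prod_unfold)
  have "(\<Sum>\<^sub>\<infinity>y. q y) = (\<Sum>\<^sub>\<infinity>z\<in>Sigma UNIV fib. cmod (p (snd z)))"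
    using infsum_Sigma_banach[OF abs_S] by (simp add: q_def)
  also have "\<dots> = (\<Sum>\<^sub>\<infinity>x\<in>X. cmod (p x))"
    by (rule infsum_reindex_bij_betw[OF bij])
  also have "\<dots> = (\<Sum>\<^sub>\<infinity>x. cmod (p x))"
    by (rule infsum_cong_neutral) (use p0 in auto)
  finally have q_bound: "(\<Sum>\<^sub>\<infinity>y. q y) \<le> ell2_norm \<xi> * ell2_norm \<eta>" using bound_p by simp
  have kq: "cmod (k y) \<le> q y" for y
    unfolding k_def q_def by (rule norm_infsum_bound) (rule abs_X)
  have k_sum: "(\<lambda>y. cmod (k y)) summable_on UNIV"
    by (rule summable_on_comparison_test[OF q]) (use kq in auto)
  have k_bound: "(\<Sum>\<^sub>\<infinity>y. cmod (k y)) \<le> ell2_norm \<xi> * ell2_norm \<eta>"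
    using infsum_mono[OF k_sum q] kq q_bound by (meson order_trans)
  have k0: "k y = 0" if "y \<notin> Y" for y
  proof -
    have "fib y = {}" using that f by (auto simp: fib_def)
    then show ?thesis by (simp add: k_def)
  qed
  have u2: "(cmod (u y))\<^sup>2 = cmod (k y)" for y by (simp add: u_def)
  have v2: "(cmod (v y))\<^sup>2 = cmod (k y)" for y
    by (simp add: v_def norm_divide power_divide) (simp add: power2_eq_square)
  have uv: "u y * cnj (v y) = k y" for y by (simp add: u_def v_def)
  have u: "u \<in> ell2 Y" using k_sum k0 by (simp add: ell2_def u2) (simp add: u_def)
  have v: "v \<in> ell2 Y" using k_sum k0 by (simp add: ell2_def v2) (simp add: v_def)
  have nu: "(ell2_norm u)\<^sup>2 \<le> ell2_norm \<xi> * ell2_norm \<eta>"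
    and nv: "(ell2_norm v)\<^sup>2 \<le> ell2_norm \<xi> * ell2_norm \<eta>"
    using k_bound by (simp_all add: ell2_norm_sq u2 v2)
  have "ell2_inner (diag_op X (g \<circ> f) \<xi>) \<eta> = ell2_inner (diag_op Y g u) v" if g: "bounded (g ` Y)" for g
  proof -
    have gf: "bounded ((g \<circ> f) ` X)" by (rule bounded_subset[OF g]) (use f in auto)
    have "(\<lambda>x. g (f x) * p x) summable_on UNIV"
      using inner_summable(2)[OF diag_op_vec(1)[OF gf \<xi>] \<eta>] by (simp add: p_def mult.assoc)
    then have "(\<lambda>x. g (f x) * p x) summable_on X"
      by (rule summable_on_subset) simp
    then have "(\<lambda>z. g (f (snd z)) * p (snd z)) summable_on (Sigma UNIV fib)"
      using summable_on_reindex_bij_betw[OF bij, of "\<lambda>x. g (f x) * p x"] by simp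
    moreover have "(\<lambda>z. g (f (snd z)) * p (snd z)) summable_on (Sigma UNIV fib) \<longleftrightarrow>
        (\<lambda>z. g (fst z) * p (snd z)) summable_on (Sigma UNIV fib)"
      by (rule summable_on_cong) (auto simp: fib_def)
    ultimately have gS: "(\<lambda>z. g (fst z) * p (snd z)) summable_on (Sigma UNIV fib)" by simp
    have "ell2_inner (diag_op X (g \<circ> f) \<xi>) \<eta> = (\<Sum>\<^sub>\<infinity>x. g (f x) * p x)"
      using \<xi> by (simp add: ell2_inner_def diag_op_def p_def mult.assoc)
    also have "\<dots> = (\<Sum>\<^sub>\<infinity>x\<in>X. g (f x) * p x)"
      by (rule infsum_cong_neutral) (use p0 in auto)
    also have "\<dots> = (\<Sum>\<^sub>\<infinity>z\<in>Sigma UNIV fib. g (f (snd z)) * p (snd z))"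
      by (rule infsum_reindex_bij_betw[OF bij, symmetric])
    also have "\<dots> = (\<Sum>\<^sub>\<infinity>z\<in>Sigma UNIV fib. g (fst z) * p (snd z))"
      by (rule infsum_cong) (auto simp: fib_def)
    also have "\<dots> = (\<Sum>\<^sub>\<infinity>y. \<Sum>\<^sub>\<infinity>x\<in>fib y. g y * p x)"
      using infsum_Sigma_banach[OF gS] by simp
    also have "\<dots> = (\<Sum>\<^sub>\<infinity>y. g y * k y)"
      by (simp add: k_def infsum_cmult_right')
    also have "\<dots> = ell2_inner (diag_op Y g u) v"
      using u by (simp add: ell2_inner_def diag_op_def mult.assoc uv)
    finally show ?thesis .
  qed
  then show ?thesis using u v nu nv by blast
qed

lemma normal_pullback:
  assumes f: "f \<in> X \<rightarrow> Y" and "\<omega> \<in> normal_functionals X"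
  shows "\<exists>\<omega>'\<in>normal_functionals Y. \<forall>A\<in>linf_alg Y. \<omega> (pullback X f A) = \<omega>' A"
proof -
  obtain \<xi> \<eta> where \<omega>: "\<omega> = (\<lambda>A. \<Sum>n::nat. ell2_inner (A (\<xi> n)) (\<eta> n))"
    and in_X: "\<And>n. \<xi> n \<in> ell2 X" "\<And>n. \<eta> n \<in> ell2 X"
    and sums: "summable (\<lambda>n. (ell2_norm (\<xi> n))\<^sup>2)" "summable (\<lambda>n. (ell2_norm (\<eta> n))\<^sup>2)"
    using assms(2) unfolding normal_functionals_def by blast
  obtain u v where uv: "\<And>n. u n \<in> ell2 Y" "\<And>n. v n \<in> ell2 Y"
    "\<And>n. (ell2_norm (u n))\<^sup>2 \<le> ell2_norm (\<xi> n) * ell2_norm (\<eta> n)"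
    "\<And>n. (ell2_norm (v n))\<^sup>2 \<le> ell2_norm (\<xi> n) * ell2_norm (\<eta> n)"
    and eq: "\<And>n g. bounded (g ` Y) \<Longrightarrow>
      ell2_inner (diag_op X (g \<circ> f) (\<xi> n)) (\<eta> n) = ell2_inner (diag_op Y g (u n)) (v n)"
  proof -
    have "\<exists>p. fst p \<in> ell2 Y \<and> snd p \<in> ell2 Y \<and>
        (ell2_norm (fst p))\<^sup>2 \<le> ell2_norm (\<xi> n) * ell2_norm (\<eta> n) \<and>
        (ell2_norm (snd p))\<^sup>2 \<le> ell2_norm (\<xi> n) * ell2_norm (\<eta> n) \<and>
        (\<forall>g. bounded (g ` Y) \<longrightarrow> ell2_inner (diag_op X (g \<circ> f) (\<xi> n)) (\<eta> n) =
          ell2_inner (diag_op Y g (fst p)) (snd p))" for n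
      using normal_fiber_sum[OF in_X(1)[of n] in_X(2)[of n] f] by force
    then obtain p where "\<forall>n. fst (p n) \<in> ell2 Y \<and> snd (p n) \<in> ell2 Y \<and>
        (ell2_norm (fst (p n)))\<^sup>2 \<le> ell2_norm (\<xi> n) * ell2_norm (\<eta> n) \<and>
        (ell2_norm (snd (p n)))\<^sup>2 \<le> ell2_norm (\<xi> n) * ell2_norm (\<eta> n) \<and>
        (\<forall>g. bounded (g ` Y) \<longrightarrow> ell2_inner (diag_op X (g \<circ> f) (\<xi> n)) (\<eta> n) =
          ell2_inner (diag_op Y g (fst (p n))) (snd (p n)))"
      by metis
    then show ?thesis using that[of "\<lambda>n. fst (p n)" "\<lambda>n. snd (p n)"] by blast
  qed
  have ab: "a * b \<le> a\<^sup>2 + b\<^sup>2" for a b :: real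
  proof -
    have "0 \<le> (a - b)\<^sup>2 + a\<^sup>2 + b\<^sup>2" by simp
    then show ?thesis by (simp add: power2_eq_square algebra_simps)
  qed
  have s: "summable (\<lambda>n. (ell2_norm (\<xi> n))\<^sup>2 + (ell2_norm (\<eta> n))\<^sup>2)"
    using sums by (rule summable_add)
  have "summable (\<lambda>n. (ell2_norm (u n))\<^sup>2)" "summable (\<lambda>n. (ell2_norm (v n))\<^sup>2)"
    by (rule summable_comparison_test'[OF s, of 0];
        use order_trans[OF uv(3) ab] order_trans[OF uv(4) ab] in simp)+
  then have "(\<lambda>A. \<Sum>n. ell2_inner (A (u n)) (v n)) \<in> normal_functionals Y"
    unfolding normal_functionals_def using uv by blast
  moreover have "\<omega> (pullback X f A) = (\<Sum>n. ell2_inner (A (u n)) (v n))" if A: "A \<in> linf_alg Y" for A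
  proof -
    obtain g where g: "A = diag_op Y g" "bounded (g ` Y)" using A by (auto simp: linf_alg_def)
    show ?thesis unfolding \<omega> g(1) pullback_diag_op[OF f] using eq[OF g(2)] by simp
  qed
  ultimately show ?thesis by (intro bexI[of _ "\<lambda>A. \<Sum>n. ell2_inner (A (u n)) (v n)"]) auto
qed

lemma quantum_function_pullback:
  assumes f: "f \<in> X \<rightarrow> Y"
  shows "quantum_function Y (linf_alg Y) X (linf_alg X) (pullback X f)"
proof -
  note pb = pullback_diag_op[OF f]
  have bnd: "bounded ((g \<circ> f) ` X)" if "bounded (g ` Y)" for g :: "'b \<Rightarrow> complex"
    by (rule bounded_subset[OF that]) (use f in auto)
  have into: "pullback X f A \<in> linf_alg X" if "A \<in> linf_alg Y" for A
    using that pb bnd by (force simp: linf_alg_def)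
  have add: "diag_op Z g + diag_op Z h = diag_op Z (\<lambda>x. g x + h x)" for Z :: "'z set" and g h
    by (auto simp: diag_op_def fun_eq_iff distrib_right)
  have scale: "op_scale c (diag_op Z g) = diag_op Z (\<lambda>x. c * g x)" for Z :: "'z set" and g c
    by (auto simp: diag_op_def fun_eq_iff)
  have one: "id_op Z = diag_op Z (\<lambda>_. 1)" for Z :: "'z set"
    by (simp add: id_op_def diag_op_def fun_eq_iff)
  show ?thesis
    unfolding quantum_function_def
  proof (intro conjI ballI allI)
    show "pullback X f ` linf_alg Y \<subseteq> linf_alg X" using into by auto
    show "pullback X f (id_op Y) = id_op X" by (simp add: one pb o_def)
  next
    fix A B assume "A \<in> linf_alg Y" "B \<in> linf_alg Y"
    then obtain g h where gh: "A = diag_op Y g" "bounded (g ` Y)" "B = diag_op Y h" "bounded (h ` Y)"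
      by (auto simp: linf_alg_def)
    show "pullback X f (A + B) = pullback X f A + pullback X f B"
      unfolding gh add pb by (simp add: o_def)
    show "pullback X f (A \<circ> B) = pullback X f A \<circ> pullback X f B"
      unfolding gh(1,3) diag_op_comp[OF gh(2,4)] pb diag_op_comp[OF bnd[OF gh(2)] bnd[OF gh(4)]]
      by (simp add: o_def)
  next
    fix c A assume "A \<in> linf_alg Y"
    then obtain g where "A = diag_op Y g" by (auto simp: linf_alg_def)
    then show "pullback X f (op_scale c A) = op_scale c (pullback X f A)"
      by (simp add: scale pb o_def)
  next
    fix A assume "A \<in> linf_alg Y"
    then obtain g where g: "A = diag_op Y g" "bounded (g ` Y)" by (auto simp: linf_alg_def)
    show "pullback X f (adj Y A) = adj X (pullback X f A)"
      unfolding g(1) adj_diag_op[OF g(2)] pb adj_diag_op[OF bnd[OF g(2)]] by (simp add: o_def)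
  next
    have top: "topspace (subtopology (weak_star Y) (linf_alg Y)) = linf_alg Y"
      by (auto simp: linf_alg_eq)
    show "continuous_map (subtopology (weak_star Y) (linf_alg Y)) (weak_star X) (pullback X f)"
      unfolding weak_star_def[of X]
    proof (rule continuous_on_generated_topo)
      fix W assume "W \<in> {{A \<in> bounded_ops X. \<omega> A \<in> U} | \<omega> U. \<omega> \<in> normal_functionals X \<and> open U}"
      then obtain \<omega> U where W: "W = {A \<in> bounded_ops X. \<omega> A \<in> U}"
        "\<omega> \<in> normal_functionals X" "open U" by blast
      obtain \<omega>' where \<omega>': "\<omega>' \<in> normal_functionals Y"
        "\<And>A. A \<in> linf_alg Y \<Longrightarrow> \<omega> (pullback X f A) = \<omega>' A"
        using normal_pullback[OF f W(2)] by blast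
      have "openin (weak_star Y) {A \<in> bounded_ops Y. \<omega>' A \<in> U}"
        unfolding weak_star_def by (rule topology_generated_by_Basis) (use \<omega>' W in blast)
      moreover have "pullback X f -` W \<inter> linf_alg Y = {A \<in> bounded_ops Y. \<omega>' A \<in> U} \<inter> linf_alg Y"
        using \<omega>'(2) into by (auto simp: W linf_alg_eq)
      ultimately show "openin (subtopology (weak_star Y) (linf_alg Y))
          (pullback X f -` W \<inter> topspace (subtopology (weak_star Y) (linf_alg Y)))"
        unfolding top openin_subtopology by blast
    next
      have "\<Union>{{A \<in> bounded_ops X. \<omega> A \<in> U} | \<omega> U. \<omega> \<in> normal_functionals X \<and> open U} = bounded_ops X"
        using topspace_weak_star[of X] by (simp add: weak_star_def topology_generated_by_topspace)
      then show "pullback X f ` topspace (subtopology (weak_star Y) (linf_alg Y))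
          \<subseteq> \<Union>{{A \<in> bounded_ops X. \<omega> A \<in> U} | \<omega> U. \<omega> \<in> normal_functionals X \<and> open U}"
        unfolding top using into by (auto simp: linf_alg_eq)
    qed
  qed
qed

section \<open>Tensor products of operators\<close>

definition slicewise :: "'j op \<Rightarrow> ('i \<times> 'j \<Rightarrow> complex) \<Rightarrow> ('i \<times> 'j \<Rightarrow> complex)" where
  "slicewise B \<psi> = (\<lambda>(i, n). B (\<lambda>m. \<psi> (i, m)) n)"

lemma ell2_slice:
  assumes "\<psi> \<in> ell2 (I \<times> J)"
  shows "(\<lambda>m. \<psi> (i, m)) \<in> ell2 J"
    and "i \<notin> I \<Longrightarrow> (\<lambda>m. \<psi> (i, m)) = 0"
    and "finite F \<Longrightarrow> (\<Sum>i\<in>F. (ell2_norm (\<lambda>m. \<psi> (i, m)))\<^sup>2) \<le> (ell2_norm \<psi>)\<^sup>2"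
proof -
  have s: "(\<lambda>p. (cmod (\<psi> p))\<^sup>2) summable_on UNIV \<times> UNIV"
    using ell2_summable[OF assms] by simp
  have "(\<lambda>m. (cmod (\<psi> (i, m)))\<^sup>2) summable_on UNIV" for i
  proof -
    have "(\<lambda>p. (cmod (\<psi> p))\<^sup>2) summable_on (Pair i ` UNIV)"
      using s by (rule summable_on_subset) auto
    then show ?thesis
      by (subst (asm) summable_on_reindex) (auto simp: inj_on_def o_def)
  qed
  then show "(\<lambda>m. \<psi> (i, m)) \<in> ell2 J"
    using ell2_outside[OF assms] by (simp add: ell2_def)
  show "i \<notin> I \<Longrightarrow> (\<lambda>m. \<psi> (i, m)) = 0"
    using ell2_outside[OF assms] by (simp add: fun_eq_iff)
  have norm: "(\<Sum>\<^sub>\<infinity>i. (ell2_norm (\<lambda>m. \<psi> (i, m)))\<^sup>2) = (ell2_norm \<psi>)\<^sup>2"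
    using infsum_Sigma_banach[OF s] by (simp add: ell2_norm_sq)
  have sum: "(\<lambda>i. (ell2_norm (\<lambda>m. \<psi> (i, m)))\<^sup>2) summable_on UNIV"
    using summable_on_Sigma_banach[of "\<lambda>i m. (cmod (\<psi> (i, m)))\<^sup>2" UNIV "\<lambda>_. UNIV"] s
    by (simp add: ell2_norm_sq case_prod_unfold)
  show "finite F \<Longrightarrow> (\<Sum>i\<in>F. (ell2_norm (\<lambda>m. \<psi> (i, m)))\<^sup>2) \<le> (ell2_norm \<psi>)\<^sup>2"
    using finite_sum_le_infsum[OF sum, of F] norm by simp
qed

lemma slicewise_ell2:
  assumes B: "B \<in> bounded_ops J" and \<psi>: "\<psi> \<in> ell2 (I \<times> J)"
    and C: "0 \<le> C" "\<And>\<psi>. \<psi> \<in> ell2 J \<Longrightarrow> ell2_norm (B \<psi>) \<le> C * ell2_norm \<psi>"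
  shows "slicewise B \<psi> \<in> ell2 (I \<times> J)" and "ell2_norm (slicewise B \<psi>) \<le> C * ell2_norm \<psi>"
proof -
  let ?s = "\<lambda>i m. \<psi> (i, m)"
  have B_slice: "B (?s i) \<in> ell2 J" for i
    using bounded_opsD(1)[OF B ell2_slice(1)[OF \<psi>]] .
  have out: "slicewise B \<psi> p = 0" if "p \<notin> I \<times> J" for p
  proof (cases "fst p \<in> I")
    case True
    with that have "snd p \<notin> J" by (auto simp: mem_Times_iff)
    then show ?thesis using ell2_outside[OF B_slice] by (simp add: slicewise_def case_prod_unfold)
  next
    case False
    then show ?thesis
      using ell2_slice(2)[OF \<psi> False] bounded_ops_zero_vec[OF B]
      by (simp add: slicewise_def case_prod_unfold)
  qed
  have fin: "(\<Sum>p\<in>F. (cmod (slicewise B \<psi> p))\<^sup>2) \<le> (C * ell2_norm \<psi>)\<^sup>2" if F: "finite F" for F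
  proof -
    have "(\<Sum>p\<in>F. (cmod (slicewise B \<psi> p))\<^sup>2) \<le>
        (\<Sum>p\<in>fst ` F \<times> snd ` F. (cmod (slicewise B \<psi> p))\<^sup>2)"
      using F by (intro sum_mono2) (auto intro: rev_image_eqI)
    also have "\<dots> = (\<Sum>i\<in>fst ` F. \<Sum>n\<in>snd ` F. (cmod (B (?s i) n))\<^sup>2)"
      by (simp add: sum.cartesian_product slicewise_def case_prod_unfold)
    also have "\<dots> \<le> (\<Sum>i\<in>fst ` F. (ell2_norm (B (?s i)))\<^sup>2)"
      using F by (intro sum_mono sum_le_norm_sq[OF B_slice]) simp
    also have "\<dots> \<le> (\<Sum>i\<in>fst ` F. C\<^sup>2 * (ell2_norm (?s i))\<^sup>2)"
      using C(2)[OF ell2_slice(1)[OF \<psi>]]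
      by (intro sum_mono) (metis power_mono power_mult_distrib ell2_norm_nonneg)
    also have "\<dots> \<le> C\<^sup>2 * (ell2_norm \<psi>)\<^sup>2"
      using ell2_slice(3)[OF \<psi>, of "fst ` F"] F by (simp add: mult_left_mono flip: sum_distrib_left)
    finally show ?thesis by (simp add: power_mult_distrib)
  qed
  show "slicewise B \<psi> \<in> ell2 (I \<times> J)" "ell2_norm (slicewise B \<psi>) \<le> C * ell2_norm \<psi>"
    using ell2I[of "I \<times> J" "slicewise B \<psi>" "C * ell2_norm \<psi>"] out fin C(1) by auto
qed

lemma ell2_swap:
  assumes "\<psi> \<in> ell2 (I \<times> J)"
  shows "\<psi> \<circ> prod.swap \<in> ell2 (J \<times> I)" and "ell2_norm (\<psi> \<circ> prod.swap) = ell2_norm \<psi>"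
proof -
  have bij: "bij_betw prod.swap UNIV UNIV" by (rule bij_swap)
  have "(\<lambda>p. (cmod (\<psi> (prod.swap p)))\<^sup>2) summable_on UNIV"
    using summable_on_reindex_bij_betw[OF bij, of "\<lambda>p. (cmod (\<psi> p))\<^sup>2"] ell2_summable[OF assms]
    by simp
  then show "\<psi> \<circ> prod.swap \<in> ell2 (J \<times> I)"
    using ell2_outside[OF assms] by (auto simp: ell2_def)
  show "ell2_norm (\<psi> \<circ> prod.swap) = ell2_norm \<psi>"
    using infsum_reindex_bij_betw[OF bij, of "\<lambda>p. (cmod (\<psi> p))\<^sup>2"] by (simp add: ell2_norm_def)
qed

lemma tensor_op_slicewise:
  "\<psi> \<in> ell2 (I \<times> J) \<Longrightarrow>
    tensor_op I J A B \<psi> = slicewise A (slicewise B \<psi> \<circ> prod.swap) \<circ> prod.swap"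
  by (simp add: tensor_op_def slicewise_def fun_eq_iff)

lemma slicewise_add:
  assumes "B \<in> bounded_ops J" "\<psi> \<in> ell2 (I \<times> J)" "\<phi> \<in> ell2 (I \<times> J)"
  shows "slicewise B (\<psi> + \<phi>) = slicewise B \<psi> + slicewise B \<phi>"
proof -
  have "(\<lambda>m. (\<psi> + \<phi>) (i, m)) = (\<lambda>m. \<psi> (i, m)) + (\<lambda>m. \<phi> (i, m))" for i
    by (simp add: fun_eq_iff)
  then have "B (\<lambda>m. (\<psi> + \<phi>) (i, m)) = B (\<lambda>m. \<psi> (i, m)) + B (\<lambda>m. \<phi> (i, m))" for i
    using bounded_opsD(2)[OF assms(1) ell2_slice(1)[OF assms(2)] ell2_slice(1)[OF assms(3)]]
    by metis
  then have "slicewise B (\<psi> + \<phi>) (i, n) = slicewise B \<psi> (i, n) + slicewise B \<phi> (i, n)" for i n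
    unfolding slicewise_def prod.case by (metis plus_fun_apply)
  then show ?thesis by (simp add: fun_eq_iff)
qed

lemma slicewise_scale:
  assumes "B \<in> bounded_ops J" "\<psi> \<in> ell2 (I \<times> J)"
  shows "slicewise B (cscale c \<psi>) = cscale c (slicewise B \<psi>)"
proof -
  have "(\<lambda>m. cscale c \<psi> (i, m)) = cscale c (\<lambda>m. \<psi> (i, m))" for i
    by (simp add: cscale_def)
  then have "B (\<lambda>m. cscale c \<psi> (i, m)) = cscale c (B (\<lambda>m. \<psi> (i, m)))" for i
    using bounded_opsD(3)[OF assms(1) ell2_slice(1)[OF assms(2)]] by metis
  then show ?thesis by (simp add: slicewise_def fun_eq_iff) (simp add: cscale_def)
qed

lemma tensor_op_bounded:
  assumes A: "A \<in> bounded_ops I" and B: "B \<in> bounded_ops J"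
  shows "tensor_op I J A B \<in> bounded_ops (I \<times> J)"
proof -
  obtain C where C: "0 \<le> C" "\<And>\<psi>. \<psi> \<in> ell2 I \<Longrightarrow> ell2_norm (A \<psi>) \<le> C * ell2_norm \<psi>"
    using A by (metis bounded_opsE)
  obtain D where D: "0 \<le> D" "\<And>\<psi>. \<psi> \<in> ell2 J \<Longrightarrow> ell2_norm (B \<psi>) \<le> D * ell2_norm \<psi>"
    using B by (metis bounded_opsE)
  let ?S = "\<lambda>\<psi>. slicewise B \<psi> \<circ> prod.swap"
  note SB = slicewise_ell2[OF B _ D]
  have S: "?S \<psi> \<in> ell2 (J \<times> I)" "ell2_norm (?S \<psi>) \<le> D * ell2_norm \<psi>" if "\<psi> \<in> ell2 (I \<times> J)" for \<psi>
    using SB[OF that] ell2_swap[OF SB(1)[OF that]] by simp_all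
  note SA = slicewise_ell2[OF A _ C]
  show ?thesis
  proof (rule bounded_opsI[where C="C * D"])
    fix \<psi> assume \<psi>: "\<psi> \<in> ell2 (I \<times> J)"
    show "tensor_op I J A B \<psi> \<in> ell2 (I \<times> J)"
      unfolding tensor_op_slicewise[OF \<psi>] by (rule ell2_swap(1)[OF SA(1)[OF S(1)[OF \<psi>]]])
    have "ell2_norm (tensor_op I J A B \<psi>) \<le> C * ell2_norm (?S \<psi>)"
      using tensor_op_slicewise[OF \<psi>, of A B] ell2_swap(2)[OF SA(1)[OF S(1)[OF \<psi>]]]
        SA(2)[OF S(1)[OF \<psi>]] by metis
    also have "\<dots> \<le> C * (D * ell2_norm \<psi>)" using S(2)[OF \<psi>] C(1) by (rule mult_left_mono)
    finally show "ell2_norm (tensor_op I J A B \<psi>) \<le> C * D * ell2_norm \<psi>" by (simp add: mult.assoc)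
    show "tensor_op I J A B (cscale c \<psi>) = cscale c (tensor_op I J A B \<psi>)" for c
    proof -
      have "slicewise B (cscale c \<psi>) \<circ> prod.swap = cscale c (?S \<psi>)"
        unfolding slicewise_scale[OF B \<psi>] by (simp add: cscale_def fun_eq_iff)
      then show ?thesis
        unfolding tensor_op_slicewise[OF \<psi>] tensor_op_slicewise[OF ell2_scale(1)[OF \<psi>]]
        using slicewise_scale[OF A S(1)[OF \<psi>], of c]
        by (simp only:) (simp add: cscale_def fun_eq_iff)
    qed
  next
    fix \<psi> \<phi> assume \<psi>: "\<psi> \<in> ell2 (I \<times> J)" and \<phi>: "\<phi> \<in> ell2 (I \<times> J)"
    have "slicewise B (\<psi> + \<phi>) \<circ> prod.swap = ?S \<psi> + ?S \<phi>"
      unfolding slicewise_add[OF B \<psi> \<phi>] by (simp add: fun_eq_iff)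
    then show "tensor_op I J A B (\<psi> + \<phi>) = tensor_op I J A B \<psi> + tensor_op I J A B \<phi>"
      unfolding tensor_op_slicewise[OF \<psi>] tensor_op_slicewise[OF \<phi>]
        tensor_op_slicewise[OF ell2_add(1)[OF \<psi> \<phi>]]
      using slicewise_add[OF A S(1)[OF \<psi>] S(1)[OF \<phi>]]
      by (simp only:) (simp add: fun_eq_iff)
  qed (simp add: tensor_op_def)
qed

lemma tensor_vec_ell2:
  assumes "\<xi> \<in> ell2 I" "\<eta> \<in> ell2 J"
  shows "tensor_vec \<xi> \<eta> \<in> ell2 (I \<times> J)"
proof (rule ell2I(1)[where C="ell2_norm \<xi> * ell2_norm \<eta>"])
  fix F :: "('a \<times> 'b) set" assume F: "finite F"
  have "(\<Sum>p\<in>F. (cmod (tensor_vec \<xi> \<eta> p))\<^sup>2) \<le>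
      (\<Sum>p\<in>fst ` F \<times> snd ` F. (cmod (tensor_vec \<xi> \<eta> p))\<^sup>2)"
    using F by (intro sum_mono2) (auto intro: rev_image_eqI)
  also have "\<dots> = (\<Sum>i\<in>fst ` F. (cmod (\<xi> i))\<^sup>2) * (\<Sum>j\<in>snd ` F. (cmod (\<eta> j))\<^sup>2)"
    by (simp add: sum_product sum.cartesian_product tensor_vec_def case_prod_unfold
        norm_mult power_mult_distrib)
  also have "\<dots> \<le> (ell2_norm \<xi>)\<^sup>2 * (ell2_norm \<eta>)\<^sup>2"
    using F sum_le_norm_sq[OF assms(1)] sum_le_norm_sq[OF assms(2)]
    by (intro mult_mono) (auto simp: sum_nonneg)
  finally show "(\<Sum>p\<in>F. (cmod (tensor_vec \<xi> \<eta> p))\<^sup>2) \<le> (ell2_norm \<xi> * ell2_norm \<eta>)\<^sup>2"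
    by (simp add: power_mult_distrib)
qed ((use ell2_outside[OF assms(1)] ell2_outside[OF assms(2)] in
    \<open>force simp: tensor_vec_def\<close>)+)

lemma tensor_op_tensor_vec:
  assumes A: "A \<in> bounded_ops I" and B: "B \<in> bounded_ops J" and \<xi>: "\<xi> \<in> ell2 I" and \<eta>: "\<eta> \<in> ell2 J"
  shows "tensor_op I J A B (tensor_vec \<xi> \<eta>) = tensor_vec (A \<xi>) (B \<eta>)"
proof -
  have 1: "B (\<lambda>m. tensor_vec \<xi> \<eta> (i, m)) = cscale (\<xi> i) (B \<eta>)" for i
    using bounded_opsD(3)[OF B \<eta>, of "\<xi> i"] by (simp add: tensor_vec_def cscale_def)
  have 2: "A (\<lambda>i. cscale (\<xi> i) (B \<eta>) n) = cscale (B \<eta> n) (A \<xi>)" for n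
    using bounded_opsD(3)[OF A \<xi>, of "B \<eta> n"] by (simp add: cscale_def mult.commute)
  show ?thesis
    using tensor_vec_ell2[OF \<xi> \<eta>] unfolding tensor_op_def
    by (simp add: 1 2 fun_eq_iff) (simp add: cscale_def tensor_vec_def mult.commute)
qed

end

theory Submission
  imports Defs
begin

text \<open>
  Projections in \<open>\<ell>\<^sub>\<infinity>(X)\<close> are indicators of sets \<open>S\<close>, and matrix units show that the quantum distance
  and diameter of indicators are the set distance \<open>inf d(x, y)\<close> and the set diameter.  For the
  diameter, projections \<open>Q\<close>, \<open>R\<close> in \<open>\<ell>\<^sub>\<infinity>(X) \<otimes> B(\<ell>\<^sub>2)\<close> are block diagonal, with blocks \<open>Q\<^sub>x\<close>, \<open>R\<^sub>y\<close>,
  so \<open>Q (B \<otimes> Id) R \<noteq> 0\<close> forces \<open>B\<^sub>x\<^sub>y Q\<^sub>x R\<^sub>y \<noteq> 0\<close> for some \<open>x\<close>, \<open>y\<close>; then the matrix unit at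
  \<open>(x, y)\<close> witnesses \<open>dist(Q, R) \<le> d(x, y)\<close>.
  The theorem follows by testing on preimages of sets with one or two points.
\<close>

section \<open>Matrix entries and matrix units\<close>

lemma bounded_op_nonzero_entry:
  assumes "A \<in> bounded_ops I" "A \<noteq> 0"
  obtains i j where "i \<in> I" "j \<in> I" "A (basis_vec i) j \<noteq> 0"
  using bounded_op_matrix_ext[OF assms(1) zero_bounded_op] assms(2) by fastforce

lemma nonzero_opI: "A \<psi> j \<noteq> 0 \<Longrightarrow> A \<noteq> 0"
  by auto

lemma id_op_bounded: "id_op I \<in> bounded_ops I"
  by (rule bounded_opsI[where C=1]) (auto simp: id_op_def ell2_add)

text \<open>The row index comes first, as in \<open>A (basis_vec y) x\<close> for the entry of A at
  (x, y): the unit at (x, y) sends \<open>basis_vec y\<close> to \<open>basis_vec x\<close>. It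
  vanishes off \<open>ell2 I\<close>, as membership in \<open>bounded_ops I\<close> demands.\<close>

definition matrix_unit :: "'i set \<Rightarrow> 'i \<Rightarrow> 'i \<Rightarrow> 'i op" where
  "matrix_unit I x y = (\<lambda>\<psi>. if \<psi> \<in> ell2 I then cscale (\<psi> y) (basis_vec x) else 0)"

lemma matrix_unit_apply: "\<psi> \<in> ell2 I \<Longrightarrow> matrix_unit I x y \<psi> = cscale (\<psi> y) (basis_vec x)"
  by (simp add: matrix_unit_def)

lemma matrix_unit_basis:
  "i \<in> I \<Longrightarrow> matrix_unit I x y (basis_vec i) j = (if i = y \<and> j = x then 1 else 0)"
  by (simp add: matrix_unit_apply) (auto simp: cscale_def basis_vec_def)

lemma matrix_unit_bounded:
  assumes "x \<in> I"
  shows "matrix_unit I x y \<in> bounded_ops I"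
\<comment> \<open>A single coordinate of a vector is bounded by its norm, so the norm of the fixed
  output vector serves as the constant.\<close>
proof (rule bounded_opsI[where C="ell2_norm (basis_vec x)"])
  fix \<psi> assume \<psi>: "\<psi> \<in> ell2 I"
  have "cmod (\<psi> y) \<le> ell2_norm \<psi>"
    using L2_set_le_ell2_norm[OF \<psi>, of "{y}"] by simp
  then show "ell2_norm (matrix_unit I x y \<psi>) \<le> ell2_norm (basis_vec x) * ell2_norm \<psi>"
    using assms ell2_scale(2)[of "basis_vec x" I "\<psi> y"]
    by (simp add: matrix_unit_apply[OF \<psi>] mult.commute[of _ "ell2_norm (basis_vec x)"] mult_left_mono)
  show "matrix_unit I x y \<psi> \<in> ell2 I"
    using assms by (simp add: matrix_unit_apply[OF \<psi>])
  show "matrix_unit I x y (cscale c \<psi>) = cscale c (matrix_unit I x y \<psi>)" for c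
    using \<psi> ell2_scale(1)[OF \<psi>, of c] by (simp add: matrix_unit_apply) (simp add: cscale_def mult.assoc)
next
  fix \<psi> \<phi> assume "\<psi> \<in> ell2 I" "\<phi> \<in> ell2 I"
  then show "matrix_unit I x y (\<psi> + \<phi>) = matrix_unit I x y \<psi> + matrix_unit I x y \<phi>"
    using ell2_add(1)[of \<psi> I \<phi>]
    by (simp add: matrix_unit_apply) (simp add: cscale_def fun_eq_iff distrib_right)
qed (simp add: matrix_unit_def)

section \<open>Indicator projections\<close>

text \<open>The set S may leave X and only \<open>X \<inter> S\<close> matters, so a full preimage
  under f can be used without cutting it down to X.\<close>

definition indicator_op :: "'x set \<Rightarrow> 'x set \<Rightarrow> 'x op" where
  "indicator_op X S = diag_op X (\<lambda>x. of_bool (x \<in> S))"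

lemma bounded_of_bool: "bounded ((\<lambda>x. of_bool (P x) :: complex) ` X)"
  by (rule bounded_subset[of "{0, 1}"]) auto

lemma indicator_op_bounded: "indicator_op X S \<in> bounded_ops X"
  by (simp add: indicator_op_def diag_op_bounded bounded_of_bool)

lemma indicator_op_linf: "indicator_op X S \<in> linf_alg X"
  unfolding linf_alg_def indicator_op_def
  by (intro CollectI exI[of _ "\<lambda>x. of_bool (x \<in> S)"] conjI refl bounded_of_bool)

lemma indicator_op_projection: "indicator_op X S \<in> projections X"
proof -
  have "cnj (of_bool (x \<in> S)) = of_bool (x \<in> S)" for x by (cases "x \<in> S") simp_all
  then show ?thesis
    using indicator_op_bounded[of X S]
    by (simp add: projections_def indicator_op_def diag_op_comp bounded_of_bool adj_diag_op
        flip: of_bool_conj)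
qed

lemma indicator_op_apply:
  "\<psi> \<in> ell2 X \<Longrightarrow> indicator_op X S \<psi> x = of_bool (x \<in> S) * \<psi> x"
  by (simp add: indicator_op_def diag_op_def)

lemma indicator_op_basis:
  "x \<in> X \<Longrightarrow> indicator_op X S (basis_vec x) = cscale (of_bool (x \<in> S)) (basis_vec x)"
  by (simp add: fun_eq_iff indicator_op_apply) (simp add: cscale_def basis_vec_def)

text \<open>This turns the nonvanishing of a product P A Q of indicators with A into a nonzero entry
  of A whose row lies in S and whose column lies in T.\<close>

lemma indicator_op_sandwich_entry:
  assumes "A \<in> bounded_ops X" "x \<in> X" "y \<in> X"
  shows "(indicator_op X S \<circ> A \<circ> indicator_op X T) (basis_vec y) x
    = of_bool (x \<in> S \<and> y \<in> T) * A (basis_vec y) x"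
proof -
  have "A (basis_vec y) \<in> ell2 X"
    using assms by (simp add: bounded_opsD(1))
  then show ?thesis
    using assms bounded_opsD(3)[OF assms(1), of "basis_vec y" "of_bool (y \<in> T)"]
    by (simp add: indicator_op_basis indicator_op_apply) (simp add: cscale_def)
qed

lemma indicator_op_eq_0_iff: "indicator_op X S = 0 \<longleftrightarrow> X \<inter> S = {}"
proof
  assume *: "indicator_op X S = 0"
  have "x \<notin> S" if "x \<in> X" for x
    using fun_cong[OF fun_cong[OF *, of "basis_vec x"], of x] that
    by (simp add: indicator_op_basis) (simp add: cscale_def basis_vec_def)
  then show "X \<inter> S = {}" by blast
next
  assume "X \<inter> S = {}"
  then show "indicator_op X S = 0"
    by (intro bounded_op_matrix_ext[OF indicator_op_bounded zero_bounded_op])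
       (auto simp: indicator_op_basis cscale_def)
qed

lemma pullback_indicator_op:
  "f \<in> X \<rightarrow> Y \<Longrightarrow> pullback X f (indicator_op Y S) = indicator_op X (f -` S)"
  by (simp add: indicator_op_def pullback_diag_op o_def)

section \<open>Projections of the canonical algebra\<close>

lemma canonical_qspace_sel [simp]:
  "qidx (canonical_qspace X d) = X"
  "qalg (canonical_qspace X d) = linf_alg X"
  "A \<in> qmet (canonical_qspace X d) t \<longleftrightarrow>
    A \<in> bounded_ops X \<and> (\<forall>x\<in>X. \<forall>y\<in>X. d x y > t \<longrightarrow> A (basis_vec x) y = 0)"
  by (simp_all add: canonical_qspace_def)

text \<open>Idempotence of a diagonal operator reads g x * g x = g x at every point of X, so g takes
  only the values 0 and 1 there. Infima and suprema over projections thus become ones over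
  sets.\<close>

lemma proj_alg_canonical: "proj_alg (canonical_qspace X d) = range (indicator_op X)"
proof
  show "range (indicator_op X) \<subseteq> proj_alg (canonical_qspace X d)"
    by (auto simp: proj_alg_def indicator_op_linf indicator_op_projection)
  show "proj_alg (canonical_qspace X d) \<subseteq> range (indicator_op X)"
  proof
    fix P assume "P \<in> proj_alg (canonical_qspace X d)"
    then have PP: "P \<circ> P = P" and "P \<in> linf_alg X"
      by (auto simp: proj_alg_def projections_def)
    then obtain g where g: "P = diag_op X g" "bounded (g ` X)" by (auto simp: linf_alg_def)
    have "g x = of_bool (g x = 1)" if "x \<in> X" for x
    proof -
      have "diag_symbol (diag_op X (\<lambda>x. g x * g x)) x = diag_symbol (diag_op X g) x"
        using PP g by (simp add: diag_op_comp)
      then have "g x * g x = g x" using that by simp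
      then show ?thesis by auto
    qed
    then have "P = indicator_op X {x. g x = 1}"
      unfolding g(1) indicator_op_def by (intro diag_op_cong) simp
    then show "P \<in> range (indicator_op X)" by blast
  qed
qed

section \<open>Amplification\<close>

lemma ell2_slice_fst:
  assumes "\<psi> \<in> ell2 (I \<times> J)"
  shows "(\<lambda>i. \<psi> (i, n)) \<in> ell2 I"
  using ell2_slice(1)[OF ell2_swap(1)[OF assms], of n] by (simp add: o_def)

lemma amp_apply:
  assumes "\<psi> \<in> ell2 (I \<times> UNIV)"
  shows "amp I A \<psi> (i, n) = A (\<lambda>j. \<psi> (j, n)) i"
  using assms ell2_slice(1)[OF assms] by (simp add: amp_def tensor_op_def id_op_def)

lemma amp_bounded: "A \<in> bounded_ops I \<Longrightarrow> amp I A \<in> bounded_ops (I \<times> UNIV)"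
  by (simp add: amp_def tensor_op_bounded id_op_bounded)

lemma amp_comp:
  assumes "A \<in> bounded_ops I" "B \<in> bounded_ops I"
  shows "amp I A \<circ> amp I B = amp I (A \<circ> B)"
proof (rule bounded_op_ext[where I="I \<times> UNIV"])
  fix \<psi> :: "'a \<times> nat \<Rightarrow> complex" assume \<psi>: "\<psi> \<in> ell2 (I \<times> UNIV)"
  have "amp I B \<psi> \<in> ell2 (I \<times> UNIV)"
    using bounded_opsD(1)[OF amp_bounded[OF assms(2)] \<psi>] .
  then show "(amp I A \<circ> amp I B) \<psi> = amp I (A \<circ> B) \<psi>"
    using \<psi> by (simp add: fun_eq_iff amp_apply)
qed (use assms in \<open>simp_all add: comp_bounded_op amp_bounded\<close>)

text \<open>Together with \<open>amp_comp\<close> this removes the tensor factor from products of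
  amplified operators. A nonzero entry of A survives because \<open>amp I A\<close> acts on the
  slice at 0 of a vector \<open>tensor_vec \<xi> (basis_vec 0)\<close> as A acts on \<xi>.\<close>

lemma amp_nonzero_iff:
  assumes A: "A \<in> bounded_ops I"
  shows "amp I A \<noteq> 0 \<longleftrightarrow> A \<noteq> 0"
proof
  assume "A \<noteq> 0"
  then obtain i j where ij: "i \<in> I" "A (basis_vec i) j \<noteq> 0"
    using bounded_op_nonzero_entry[OF A] by metis
  have v: "tensor_vec (basis_vec i) (basis_vec (0::nat)) \<in> ell2 (I \<times> UNIV)"
    using ij by (simp add: tensor_vec_ell2)
  have "amp I A (tensor_vec (basis_vec i) (basis_vec 0)) (j, 0) \<noteq> 0"
    unfolding amp_apply[OF v] using ij by (simp add: tensor_vec_def) (simp add: basis_vec_def)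
  then show "amp I A \<noteq> 0" by - (rule nonzero_opI)
next
  assume *: "amp I A \<noteq> 0"
  show "A \<noteq> 0"
  proof
    assume "A = 0"
    then have "amp I A = 0"
      by (intro bounded_op_ext[OF amp_bounded[OF A] zero_bounded_op])
         (simp add: fun_eq_iff amp_apply)
    with * show False by simp
  qed
qed

text \<open>In this form an amplified indicator is visibly a projection on the tensor product, by
  \<open>indicator_op_projection\<close>.\<close>

lemma amp_indicator_op: "amp X (indicator_op X S) = indicator_op (X \<times> UNIV) (S \<times> UNIV)"
  by (rule bounded_op_ext[OF amp_bounded[OF indicator_op_bounded] indicator_op_bounded])
     (simp add: fun_eq_iff amp_apply indicator_op_apply ell2_slice_fst)

section \<open>The tensor product of the algebra with the operators on l_2\<close>

lemma amp_in_vn_tensor: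
  assumes "M \<subseteq> bounded_ops I" "A \<in> M"
  shows "amp I A \<in> vn_tensor_B_ell2 I M"
proof -
  let ?G = "{tensor_op I UNIV A B | A B. A \<in> M \<and> B \<in> bounded_ops (UNIV :: nat set)}"
  \<comment> \<open>A set lies in its closure only if it is part of the topological space, which
    here consists of the bounded operators.\<close>
  have "op_subspace hull ?G \<subseteq> bounded_ops (I \<times> UNIV)"
    by (rule hull_minimal)
       (use assms in \<open>auto simp: op_subspace_def tensor_op_bounded zero_bounded_op add_bounded_op
          scale_bounded_op\<close>)
  then have "op_subspace hull ?G \<subseteq> vn_tensor_B_ell2 I M"
    unfolding vn_tensor_B_ell2_def by (intro closure_of_subset) simp
  moreover have "amp I A \<in> op_subspace hull ?G"
    by (rule hull_inc) (use assms id_op_bounded in \<open>auto simp: amp_def\<close>)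
  ultimately show ?thesis by blast
qed

text \<open>A generator \<open>tensor_op X UNIV A B\<close> with A diagonal has no entries between
  different points of X. The vanishing of prescribed entries defines a weak* closed subspace, so it
  passes to the span and then to its closure.\<close>

lemma vn_tensor_block_diagonal:
  assumes "Q \<in> vn_tensor_B_ell2 X (linf_alg X)"
  shows "Q \<in> bounded_ops (X \<times> UNIV)"
    and "x \<in> X \<Longrightarrow> y \<in> X \<Longrightarrow> x \<noteq> y \<Longrightarrow> Q (basis_vec (x, n)) (y, m) = 0"
proof -
  let ?D = "{A \<in> bounded_ops (X \<times> UNIV). \<forall>p\<in>X \<times> UNIV. \<forall>q\<in>X \<times> UNIV.
    fst p \<noteq> fst q \<longrightarrow> A (basis_vec p) q = 0}"
  let ?G = "{tensor_op X UNIV A B | A B. A \<in> linf_alg X \<and> B \<in> bounded_ops (UNIV :: nat set)}"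
  have "?G \<subseteq> ?D"
  proof
    fix T assume "T \<in> ?G"
    then obtain A B where T: "T = tensor_op X UNIV A B" and A: "A \<in> linf_alg X"
      and B: "B \<in> bounded_ops (UNIV :: nat set)" by blast
    have Ab: "A \<in> bounded_ops X" using A by (simp add: linf_alg_eq)
    have "T (basis_vec (x, n)) (y, m) = 0" if "x \<in> X" "y \<in> X" "x \<noteq> y" for x y n m
    proof -
      have "basis_vec (x, n) = tensor_vec (basis_vec x) (basis_vec n)"
        by (auto simp: basis_vec_def tensor_vec_def fun_eq_iff)
      then have "T (basis_vec (x, n)) = tensor_vec (A (basis_vec x)) (B (basis_vec n))"
        using tensor_op_tensor_vec[OF Ab B, of "basis_vec x" "basis_vec n"] that T by simp
      then show ?thesis using A that by (simp add: tensor_vec_def linf_alg_eq)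
    qed
    then show "T \<in> ?D" using tensor_op_bounded[OF Ab B] T by auto
  qed
  then have "op_subspace hull ?G \<subseteq> ?D"
    by (rule hull_minimal) (rule op_subspace_matrix_zeros)
  then have "vn_tensor_B_ell2 X (linf_alg X) \<subseteq> ?D"
    unfolding vn_tensor_B_ell2_def by (rule closure_of_minimal) (rule closedin_matrix_zeros)
  then show "Q \<in> bounded_ops (X \<times> UNIV)"
    and "x \<in> X \<Longrightarrow> y \<in> X \<Longrightarrow> x \<noteq> y \<Longrightarrow> Q (basis_vec (x, n)) (y, m) = 0"
    using assms by auto
qed

text \<open>R keeps \<open>basis_vec (y, m)\<close> in the fibre over y, and the coordinates of Q
  over x depend only on the fibre over x. Between these two fibres \<open>amp X B\<close> acts as
  the scalar \<open>B (basis_vec y) x\<close>, so the chosen entry is this scalar times the same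
  entry with the matrix unit in place of B.\<close>

lemma block_diagonal_amp_entry:
  assumes Q: "Q \<in> vn_tensor_B_ell2 X (linf_alg X)" and R: "R \<in> vn_tensor_B_ell2 X (linf_alg X)"
    and B: "B \<in> bounded_ops X" and nz: "Q \<circ> amp X B \<circ> R \<noteq> 0"
  obtains x y where "x \<in> X" "y \<in> X" "B (basis_vec y) x \<noteq> 0"
    "Q \<circ> amp X (matrix_unit X x y) \<circ> R \<noteq> 0"
proof -
  note Qb = vn_tensor_block_diagonal(1)[OF Q] and Rb = vn_tensor_block_diagonal(1)[OF R]
  have "Q \<circ> amp X B \<circ> R \<in> bounded_ops (X \<times> UNIV)"
    by (intro comp_bounded_op Qb Rb amp_bounded B)
  then obtain p q where "p \<in> X \<times> UNIV" "q \<in> X \<times> UNIV"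
    "(Q \<circ> amp X B \<circ> R) (basis_vec p) q \<noteq> 0"
    using nz by (rule bounded_op_nonzero_entry)
  then obtain y m x n where xy: "x \<in> X" "y \<in> X"
    and entry: "Q (amp X B (R (basis_vec (y, m)))) (x, n) \<noteq> 0"
    by auto
  define \<psi> where "\<psi> = R (basis_vec (y, m))"
  define E where "E = matrix_unit X x y"
  define b where "b = B (basis_vec y) x"
  have \<psi>: "\<psi> \<in> ell2 (X \<times> UNIV)"
    using bounded_opsD(1)[OF Rb, of "basis_vec (y, m)"] xy by (simp add: \<psi>_def)
  have Eb: "E \<in> bounded_ops X" by (simp add: E_def matrix_unit_bounded xy)
  \<comment> \<open>Block diagonality of R: the vector \<psi> is supported on the fibre over
    y.\<close>
  have slice: "(\<lambda>j. \<psi> (j, k)) = cscale (\<psi> (y, k)) (basis_vec y)" for k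
  proof
    fix j
    show "\<psi> (j, k) = cscale (\<psi> (y, k)) (basis_vec y) j"
      using vn_tensor_block_diagonal(2)[OF R, of y j m k] ell2_outside[OF \<psi>, of "(j, k)"] xy
      by (cases "j \<in> X") (auto simp: cscale_def basis_vec_def \<psi>_def)
  qed
  have Bx: "amp X B \<psi> (x, k) = b * amp X E \<psi> (x, k)" for k
    using xy bounded_opsD(3)[OF B, of "basis_vec y"] bounded_opsD(3)[OF Eb, of "basis_vec y"]
    unfolding amp_apply[OF \<psi>] slice
    by (simp add: b_def E_def matrix_unit_basis) (simp add: cscale_def E_def matrix_unit_basis)
  \<comment> \<open>By \<open>Bx\<close> this difference vanishes on the fibre over x, hence so does
    its image under the block diagonal Q. Linearity of Q then carries the scalar b outside.\<close>
  let ?\<chi> = "amp X B \<psi> + cscale (- b) (amp X E \<psi>)"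
  have in2: "amp X B \<psi> \<in> ell2 (X \<times> UNIV)" "amp X E \<psi> \<in> ell2 (X \<times> UNIV)"
    using bounded_opsD(1)[OF amp_bounded \<psi>] B Eb by auto
  have "Q ?\<chi> (x, n) = 0"
  proof (rule bounded_op_apply_eq_0[OF Qb])
    show "?\<chi> \<in> ell2 (X \<times> UNIV)" using in2 by (simp add: ell2_add)
    fix p assume p: "p \<in> X \<times> UNIV" "?\<chi> p \<noteq> 0"
    obtain j k where jk: "p = (j, k)" by (cases p)
    have "j \<noteq> x" using p(2) Bx by (auto simp: jk cscale_def)
    then show "Q (basis_vec p) (x, n) = 0"
      using vn_tensor_block_diagonal(2)[OF Q, of j x k n] p(1) xy by (auto simp: jk)
  qed
  moreover have "Q ?\<chi> = Q (amp X B \<psi>) + cscale (- b) (Q (amp X E \<psi>))"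
    using in2 by (simp add: bounded_opsD[OF Qb])
  ultimately have "Q (amp X B \<psi>) (x, n) = b * Q (amp X E \<psi>) (x, n)"
    by (simp add: cscale_def)
  with entry have "b \<noteq> 0" "Q (amp X E \<psi>) (x, n) \<noteq> 0" by (auto simp: \<psi>_def)
  then have "Q \<circ> amp X E \<circ> R \<noteq> 0"
    by (intro nonzero_opI[of _ "basis_vec (y, m)" "(x, n)"]) (simp add: \<psi>_def)
  with \<open>b \<noteq> 0\<close> xy show thesis by (intro that) (auto simp: b_def E_def)
qed

section \<open>Distance and diameter of indicator projections\<close>

context Metric_space
begin

text \<open>The only nonzero entry leads from y to x, at distance d y x; symmetry of d gives the
  stated parameter.\<close>

lemma matrix_unit_in_qmet:
  "x \<in> M \<Longrightarrow> y \<in> M \<Longrightarrow> matrix_unit M x y \<in> qmet (canonical_qspace M d) (d x y)"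
  by (auto simp: matrix_unit_bounded matrix_unit_basis commute)

text \<open>Matrix units at pairs from S and T attain the upper bound. Conversely, if P A Q is
  nonzero then A has a nonzero entry at some such pair, and membership of A in \<open>qmet\<close>
  at t forces the distance of that pair to be at most t.\<close>

lemma qdist_indicator_op:
  "qdist (canonical_qspace M d) (indicator_op M S) (indicator_op M T)
    = Inf {ennreal (d x y) | x y. x \<in> M \<inter> S \<and> y \<in> M \<inter> T}" (is "?l = Inf ?D")
proof (rule antisym)
  let ?P = "indicator_op M S" and ?Q = "indicator_op M T"
  have amp_iff: "amp M ?P \<circ> amp M A \<circ> amp M ?Q \<noteq> 0 \<longleftrightarrow> ?P \<circ> A \<circ> ?Q \<noteq> 0"
    if "A \<in> bounded_ops M" for A
    using that by (simp add: amp_comp indicator_op_bounded comp_bounded_op amp_nonzero_iff)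
  show "?l \<le> Inf ?D"
  proof (rule Inf_greatest)
    fix r assume "r \<in> ?D"
    then obtain x y where r: "r = ennreal (d x y)" and xy: "x \<in> M" "x \<in> S" "y \<in> M" "y \<in> T"
      by blast
    have b: "matrix_unit M x y \<in> bounded_ops M" using xy by (simp add: matrix_unit_bounded)
    have "(?P \<circ> matrix_unit M x y \<circ> ?Q) (basis_vec y) x \<noteq> 0"
      unfolding indicator_op_sandwich_entry[OF b xy(1,3)] using xy by (simp add: matrix_unit_basis)
    then have "?P \<circ> matrix_unit M x y \<circ> ?Q \<noteq> 0" by - (rule nonzero_opI)
    then have "amp M ?P \<circ> amp M (matrix_unit M x y) \<circ> amp M ?Q \<noteq> 0"
      using amp_iff[OF b] by simp
    then show "?l \<le> r"
      unfolding qdist_def qdist_amp_def canonical_qspace_sel(1) r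
      using matrix_unit_in_qmet[OF xy(1,3)] by (intro Inf_lower) (blast intro: nonneg)
  qed
  show "Inf ?D \<le> ?l"
    unfolding qdist_def qdist_amp_def canonical_qspace_sel(1)
  proof (rule Inf_greatest)
    fix r assume "r \<in> {ennreal t | t. 0 \<le> t \<and> (\<exists>A\<in>qmet (canonical_qspace M d) t.
      amp M ?P \<circ> amp M A \<circ> amp M ?Q \<noteq> 0)}"
    then obtain t A where r: "r = ennreal t" and A: "A \<in> qmet (canonical_qspace M d) t"
      and "amp M ?P \<circ> amp M A \<circ> amp M ?Q \<noteq> 0" by blast
    moreover have Ab: "A \<in> bounded_ops M" using A by simp
    ultimately have "?P \<circ> A \<circ> ?Q \<noteq> 0" using amp_iff by simp
    moreover have "?P \<circ> A \<circ> ?Q \<in> bounded_ops M"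
      by (intro comp_bounded_op indicator_op_bounded Ab)
    ultimately obtain y x where "x \<in> M" "y \<in> M" "(?P \<circ> A \<circ> ?Q) (basis_vec y) x \<noteq> 0"
      using bounded_op_nonzero_entry by metis
    then have xy: "x \<in> M" "y \<in> M" "x \<in> S" "y \<in> T" "A (basis_vec y) x \<noteq> 0"
      using indicator_op_sandwich_entry[OF Ab] by auto
    then have "d x y \<le> t" using A commute by force
    then have "ennreal (d x y) \<le> r" by (simp add: r ennreal_leI)
    then show "Inf ?D \<le> r" using xy by (intro Inf_lower2[of "ennreal (d x y)"]) auto
  qed
qed

text \<open>The block argument is applied to the compression of A by the indicator of S: a nonzero
  entry of it at (x, y) places both points in S, and the matrix unit at (x, y) bounds the quantum
  distance.\<close>

lemma qdist_amp_le:
  assumes Q: "Q \<in> vn_tensor_B_ell2 M (linf_alg M)" and R: "R \<in> vn_tensor_B_ell2 M (linf_alg M)"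
    and A: "A \<in> bounded_ops M"
    and nz: "Q \<circ> amp M (indicator_op M S \<circ> A \<circ> indicator_op M S) \<circ> R \<noteq> 0"
  obtains x y where "x \<in> M \<inter> S" "y \<in> M \<inter> S"
    "qdist_amp (canonical_qspace M d) Q R \<le> ennreal (d x y)"
proof -
  have "indicator_op M S \<circ> A \<circ> indicator_op M S \<in> bounded_ops M"
    by (intro comp_bounded_op indicator_op_bounded A)
  then obtain x y where xy: "x \<in> M" "y \<in> M"
    and entry: "(indicator_op M S \<circ> A \<circ> indicator_op M S) (basis_vec y) x \<noteq> 0"
    and E: "Q \<circ> amp M (matrix_unit M x y) \<circ> R \<noteq> 0"
    using block_diagonal_amp_entry[OF Q R _ nz] by metis
  have "x \<in> S" "y \<in> S"
    using entry indicator_op_sandwich_entry[OF A xy] by auto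
  moreover have "qdist_amp (canonical_qspace M d) Q R \<le> ennreal (d x y)"
    unfolding qdist_amp_def canonical_qspace_sel(1)
    using matrix_unit_in_qmet[OF xy] E by (intro Inf_lower) (blast intro: nonneg)
  ultimately show thesis using that xy by blast
qed

text \<open>Every admissible pair of projections is bounded by \<open>qdist_amp_le\<close>; the
  point projections at x and y, linked by the matrix unit at (x, y), realise d x y itself.\<close>

lemma qdiam_indicator_op:
  "qdiam (canonical_qspace M d) (indicator_op M S)
    = Sup {ennreal (d x y) | x y. x \<in> M \<inter> S \<and> y \<in> M \<inter> S}" (is "?l = Sup ?D")
proof (cases "M \<inter> S = {}")
  \<comment> \<open>The empty supremum in \<open>ennreal\<close> is 0, in agreement with the
    convention for the diameter of the zero projection.\<close>
  case True
  then have "?D = {}" by blast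
  moreover have "?l = 0" using True by (simp add: qdiam_def indicator_op_eq_0_iff)
  ultimately show ?thesis by (simp only: Sup_empty bot_ennreal)
next
  case False
  let ?P = "indicator_op M S"
  let ?C = "{qdist_amp (canonical_qspace M d) Q R | Q R.
    Q \<in> proj_amp (canonical_qspace M d) \<and> R \<in> proj_amp (canonical_qspace M d) \<and>
    (\<exists>A\<in>bounded_ops M. Q \<circ> amp M (?P \<circ> A \<circ> ?P) \<circ> R \<noteq> 0)}"
  have l: "?l = Sup ?C" using False by (simp add: qdiam_def indicator_op_eq_0_iff)
  show ?thesis
    unfolding l
  proof (rule antisym; rule Sup_least)
    fix r assume "r \<in> ?C"
    then obtain Q R A where r: "r = qdist_amp (canonical_qspace M d) Q R"
      and "Q \<in> vn_tensor_B_ell2 M (linf_alg M)" "R \<in> vn_tensor_B_ell2 M (linf_alg M)"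
        "A \<in> bounded_ops M" "Q \<circ> amp M (?P \<circ> A \<circ> ?P) \<circ> R \<noteq> 0"
      by (auto simp: proj_amp_def)
    then obtain x y where "x \<in> M \<inter> S" "y \<in> M \<inter> S" "r \<le> ennreal (d x y)"
      unfolding r using qdist_amp_le by metis
    then show "r \<le> Sup ?D" by (intro Sup_upper2[of "ennreal (d x y)"]) auto
  next
    fix r assume "r \<in> ?D"
    then obtain x y where r: "r = ennreal (d x y)" and xy: "x \<in> M" "x \<in> S" "y \<in> M" "y \<in> S"
      by blast
    \<comment> \<open>Witnesses for the lower bound: the amplified point projections at x and y as Q
      and R, and the matrix unit as the linking operator.\<close>
    let ?p = "\<lambda>x. indicator_op M {x}" and ?E = "matrix_unit M x y"
    have proj: "amp M (?p z) \<in> proj_amp (canonical_qspace M d)" for z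
    proof -
      have "amp M (?p z) \<in> vn_tensor_B_ell2 M (linf_alg M)"
        by (rule amp_in_vn_tensor[OF _ indicator_op_linf]) (auto simp: linf_alg_def diag_op_bounded)
      then show ?thesis
        by (simp add: proj_amp_def amp_indicator_op indicator_op_projection)
    qed
    have Eb: "?E \<in> bounded_ops M" using xy by (simp add: matrix_unit_bounded)
    have Pb: "?P \<circ> ?E \<circ> ?P \<in> bounded_ops M"
      by (intro comp_bounded_op indicator_op_bounded Eb)
    have "(?p x \<circ> (?P \<circ> ?E \<circ> ?P) \<circ> ?p y) (basis_vec y) x \<noteq> 0"
      unfolding indicator_op_sandwich_entry[OF Pb xy(1,3)]
        indicator_op_sandwich_entry[OF Eb xy(1,3)]
      using xy by (simp add: matrix_unit_basis)
    then have "?p x \<circ> (?P \<circ> ?E \<circ> ?P) \<circ> ?p y \<noteq> 0" by - (rule nonzero_opI)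
    then have "amp M (?p x) \<circ> amp M (?P \<circ> ?E \<circ> ?P) \<circ> amp M (?p y) \<noteq> 0"
      using Pb by (simp add: amp_comp indicator_op_bounded comp_bounded_op amp_nonzero_iff)
    then have "qdist (canonical_qspace M d) (?p x) (?p y) \<in> ?C"
      unfolding qdist_def canonical_qspace_sel(1) using proj Eb by blast
    moreover have "qdist (canonical_qspace M d) (?p x) (?p y) = r"
    proof -
      have "{ennreal (d a b) | a b. a \<in> M \<inter> {x} \<and> b \<in> M \<inter> {y}} = {r}"
        using xy r by auto
      then show ?thesis by (simp add: qdist_indicator_op)
    qed
    ultimately have "r \<in> ?C" by (simp only:)
    then show "r \<le> Sup ?C" by (rule Sup_upper)
  qed
qed

end

section \<open>Comparison of the quantum and the metric moduli\<close>

theorem proposition3p3: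
  fixes X :: "'x set" and dX :: "'x \<Rightarrow> 'x \<Rightarrow> real"
    and Y :: "'y set" and dY :: "'y \<Rightarrow> 'y \<Rightarrow> real"
    and f :: "'x \<Rightarrow> 'y"
  assumes "Metric_space X dX" and "Metric_space Y dY" and "f \<in> X \<rightarrow> Y"
  shows "\<forall>t\<ge>0.
    q_omega (canonical_qspace Y dY) (canonical_qspace X dX) (pullback X f) t = m_omega X dX dY f t \<and>
    q_rho (canonical_qspace Y dY) (canonical_qspace X dX) (pullback X f) t = m_rho X dX dY f t"
proof (intro allI impI conjI)
  fix t :: real assume t: "0 \<le> t"
  interpret X: Metric_space X dX by fact
  interpret Y: Metric_space Y dY by fact
  note fY = funcset_mem[OF assms(3)]
  define distX where "distX = (\<lambda>S T. Inf {ennreal (dX x y) | x y. x \<in> X \<inter> S \<and> y \<in> X \<inter> T})"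
  define distY where "distY = (\<lambda>S T. Inf {ennreal (dY x y) | x y. x \<in> Y \<inter> S \<and> y \<in> Y \<inter> T})"
  define diamX where "diamX = (\<lambda>S. Sup {ennreal (dX x y) | x y. x \<in> X \<inter> S \<and> y \<in> X \<inter> S})"
  define diamY where "diamY = (\<lambda>S. Sup {ennreal (dY x y) | x y. x \<in> Y \<inter> S \<and> y \<in> Y \<inter> S})"
  have "q_omega (canonical_qspace Y dY) (canonical_qspace X dX) (pullback X f) t
      = Inf {distX (f -` S) (f -` T) | S T. ennreal t \<le> distY S T}"
  proof -
    \<comment> \<open>Reindexing from projections to sets, so that the formulas for indicators can
      rewrite the whole expression.\<close>
    have "{F P Q | P Q. P \<in> range h \<and> Q \<in> range h \<and> C P Q} = {F (h S) (h T) | S T. C (h S) (h T)}"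
      for F :: "'y op \<Rightarrow> 'y op \<Rightarrow> ennreal" and h :: "'y set \<Rightarrow> 'y op" and C by blast
    then show ?thesis
      by (simp only: q_omega_def proj_alg_canonical distX_def distY_def
          pullback_indicator_op[OF assms(3)] X.qdist_indicator_op Y.qdist_indicator_op)
  qed
  also have "\<dots> = m_omega X dX dY f t"
    unfolding m_omega_def
  proof (rule antisym; rule Inf_greatest)
    fix r assume "r \<in> {ennreal (dX x y) | x y. x \<in> X \<and> y \<in> X \<and> t \<le> dY (f x) (f y)}"
    then obtain x y where r: "r = ennreal (dX x y)" "x \<in> X" "y \<in> X" "t \<le> dY (f x) (f y)"
      by blast
    \<comment> \<open>Test on the point projections at f x and f y; x and y lie in the preimages of
      these points, which bounds the distance of the preimages.\<close>
    have "ennreal t \<le> distY {f x} {f y}"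
      unfolding distY_def by (rule Inf_greatest) (use r in \<open>auto intro: ennreal_leI\<close>)
    moreover have "distX (f -` {f x}) (f -` {f y}) \<le> r"
      unfolding distX_def by (rule Inf_lower) (use r in auto)
    ultimately show "Inf {distX (f -` S) (f -` T) | S T. ennreal t \<le> distY S T} \<le> r"
      by (intro Inf_lower2[of "distX (f -` {f x}) (f -` {f y})"]) blast+
  next
    fix r assume "r \<in> {distX (f -` S) (f -` T) | S T. ennreal t \<le> distY S T}"
    then obtain S T where r: "r = distX (f -` S) (f -` T)" and ST: "ennreal t \<le> distY S T"
      by blast
    show "Inf {ennreal (dX x y) | x y. x \<in> X \<and> y \<in> X \<and> t \<le> dY (f x) (f y)} \<le> r"
      unfolding r distX_def
    \<comment> \<open>Points x and y in the preimages of S and T have images at distance at least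
      \<open>distY S T\<close>, hence at least t, so every pair on the right occurs in the infimum
      on the left.\<close>
    proof (rule Inf_superset_mono, safe)
      fix x y assume xy: "x \<in> X" "f x \<in> S" "y \<in> X" "f y \<in> T"
      have "distY S T \<le> ennreal (dY (f x) (f y))"
        unfolding distY_def by (rule Inf_lower) (use xy fY in blast)
      with ST have "t \<le> dY (f x) (f y)" by (metis Y.nonneg ennreal_le_iff order_trans)
      then show "\<exists>x' y'. ennreal (dX x y) = ennreal (dX x' y') \<and> x' \<in> X \<and> y' \<in> X \<and>
        t \<le> dY (f x') (f y')" using xy by blast
    qed
  qed
  finally show "q_omega (canonical_qspace Y dY) (canonical_qspace X dX) (pullback X f) t
    = m_omega X dX dY f t" .
  have "q_rho (canonical_qspace Y dY) (canonical_qspace X dX) (pullback X f) t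
      = Sup {diamX (f -` S) | S. diamY S \<le> ennreal t}"
  proof -
    have "{F P | P. P \<in> range h \<and> C P} = {F (h S) | S. C (h S)}"
      for F :: "'y op \<Rightarrow> ennreal" and h :: "'y set \<Rightarrow> 'y op" and C by blast
    then show ?thesis
      by (simp only: q_rho_def proj_alg_canonical diamX_def diamY_def
          pullback_indicator_op[OF assms(3)] X.qdiam_indicator_op Y.qdiam_indicator_op)
  qed
  also have "\<dots> = m_rho X dX dY f t"
    unfolding m_rho_def
  proof (rule antisym; rule Sup_least)
    fix r assume "r \<in> {ennreal (dX x y) | x y. x \<in> X \<and> y \<in> X \<and> dY (f x) (f y) \<le> t}"
    then obtain x y where r: "r = ennreal (dX x y)" "x \<in> X" "y \<in> X" "dY (f x) (f y) \<le> t"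
      by blast
    \<comment> \<open>The distances within this set are 0 and the distance from f x to f y;
      nonnegativity of t covers the former.\<close>
    have "diamY {f x, f y} \<le> ennreal t"
      unfolding diamY_def
      by (rule Sup_least) (use r t fY in \<open>auto intro!: ennreal_leI simp: Y.commute\<close>)
    moreover have "r \<le> diamX (f -` {f x, f y})"
      unfolding diamX_def by (rule Sup_upper) (use r in auto)
    ultimately show "r \<le> Sup {diamX (f -` S) | S. diamY S \<le> ennreal t}"
      by (intro Sup_upper2[of "diamX (f -` {f x, f y})"]) blast+
  next
    fix r assume "r \<in> {diamX (f -` S) | S. diamY S \<le> ennreal t}"
    then obtain S where r: "r = diamX (f -` S)" and S: "diamY S \<le> ennreal t"
      by blast
    show "r \<le> Sup {ennreal (dX x y) | x y. x \<in> X \<and> y \<in> X \<and> dY (f x) (f y) \<le> t}"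
      unfolding r diamX_def
    \<comment> \<open>Points in the preimage of S have images at distance at most
      \<open>diamY S\<close>, hence at most t.\<close>
    proof (rule Sup_subset_mono, safe)
      fix x y assume xy: "x \<in> X" "f x \<in> S" "y \<in> X" "f y \<in> S"
      have "ennreal (dY (f x) (f y)) \<le> diamY S"
        unfolding diamY_def by (rule Sup_upper) (use xy fY in blast)
      \<comment> \<open>Since \<open>ennreal\<close> sends negative reals to 0, nonnegativity of t
        is what allows the inequality to be read in the reals.\<close>
      with S have "dY (f x) (f y) \<le> t" using t by (metis ennreal_le_iff order_trans)
      then show "\<exists>x' y'. ennreal (dX x y) = ennreal (dX x' y') \<and> x' \<in> X \<and> y' \<in> X \<and>
        dY (f x') (f y') \<le> t" using xy by blast
    qed
  qed
  finally show "q_rho (canonical_qspace Y dY) (canonical_qspace X dX) (pullback X f) t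
    = m_rho X dX dY f t" .
qed

end
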